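(* Let $\mathfrak{H}$ be a complex separable Hilbert space of infinite dimension, let $T$ be a bounded self-adjoint operator on $\mathfrak{H}$, and let $S:\mathfrak{H}\to\mathfrak{H}$ be a compact self-adjoint operator. For $\lambda\in\mathbb{R}$ put $D(\lambda)=E_{(-\infty,\lambda)}(T+S)-E_{(-\infty,\lambda)}(T)$. Then the following assertions hold true. (1) If $\lambda\in\mathbb{R}\setminus\sigma_{\mathrm{ess}}(T)$, then $D(\lambda)$ is a compact operator. In particular, zero belongs to the essential spectrum of $D(\lambda)$. (2) Zero belongs to the essential spectrum of $D(\lambda)$ for all but at most countably many $\lambda$ in $\sigma_{\mathrm{ess}}(T)$.
   Context: $E_\Omega(X)$ denotes the spectral projection of a self-adjoint operator $X$ associated with the Borel set $\Omega\subset\mathbb{R}$, and $\sigma_{\mathrm{ess}}(X)$ its essential spectrum. *)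

theory Defs
  imports "HOL-Analysis.Analysis"
begin

text \<open>The inner product is linear in its first argument. Its positive definiteness is part of
  \<open>power2_norm_eq_cinner\<close>, since the norm is a norm; completeness comes from \<open>banach\<close>.\<close>

class complex_hilbert_space = banach +
  fixes scaleC :: "complex \<Rightarrow> 'a \<Rightarrow> 'a" (infixr \<open>*\<^sub>C\<close> 75)
    and cinner :: "'a \<Rightarrow> 'a \<Rightarrow> complex"
  assumes scaleC_add_right: "c *\<^sub>C (x + y) = c *\<^sub>C x + c *\<^sub>C y"
    and scaleC_add_left: "(c + d) *\<^sub>C x = c *\<^sub>C x + d *\<^sub>C x"
    and scaleC_scaleC: "c *\<^sub>C d *\<^sub>C x = (c * d) *\<^sub>C x"
    and scaleC_of_real: "complex_of_real r *\<^sub>C x = r *\<^sub>R x"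
    and cinner_commute: "cinner x y = cnj (cinner y x)"
    and cinner_add_left: "cinner (x + y) z = cinner x z + cinner y z"
    and cinner_scaleC_left: "cinner (c *\<^sub>C x) y = c * cinner x y"
    and power2_norm_eq_cinner: "complex_of_real ((norm x)\<^sup>2) = cinner x x"

lemma scaleC_one: "1 *\<^sub>C x = (x::'a::complex_hilbert_space)"
  using scaleC_of_real[of 1 x] by simp

global_interpretation complex_vector:
  vector_space "scaleC :: complex \<Rightarrow> 'a \<Rightarrow> 'a::complex_hilbert_space"
  by standard (simp_all add: scaleC_add_right scaleC_add_left scaleC_scaleC scaleC_one)

definition finite_dim :: "'a::complex_hilbert_space set \<Rightarrow> bool" where
  "finite_dim V \<longleftrightarrow> (\<exists>B. finite B \<and> complex_vector.span B = V)"

definition bounded_op :: "('a::complex_hilbert_space \<Rightarrow> 'a) \<Rightarrow> bool" where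
  "bounded_op A \<longleftrightarrow> Vector_Spaces.linear scaleC scaleC A \<and> (\<exists>K. \<forall>x. norm (A x) \<le> K * norm x)"

definition self_adjoint :: "('a::complex_hilbert_space \<Rightarrow> 'a) \<Rightarrow> bool" where
  "self_adjoint A \<longleftrightarrow> bounded_op A \<and> (\<forall>x y. cinner (A x) y = cinner x (A y))"

definition compact_op :: "('a::complex_hilbert_space \<Rightarrow> 'a) \<Rightarrow> bool" where
  "compact_op A \<longleftrightarrow>
     Vector_Spaces.linear scaleC scaleC A \<and> (\<forall>B. bounded B \<longrightarrow> compact (closure (A ` B)))"

definition orthogonal_projection :: "('a::complex_hilbert_space \<Rightarrow> 'a) \<Rightarrow> bool" where
  "orthogonal_projection P \<longleftrightarrow> self_adjoint P \<and> P \<circ> P = P"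

definition resolvent_set :: "('a::complex_hilbert_space \<Rightarrow> 'a) \<Rightarrow> complex set" where
  "resolvent_set A = {z. \<exists>R. bounded_op R \<and>
     (\<forall>x. R (A x - z *\<^sub>C x) = x) \<and> (\<forall>x. A (R x) - z *\<^sub>C R x = x)}"

definition spectrum :: "('a::complex_hilbert_space \<Rightarrow> 'a) \<Rightarrow> complex set" where
  "spectrum A = - resolvent_set A"

definition eigenspace :: "('a::complex_hilbert_space \<Rightarrow> 'a) \<Rightarrow> complex \<Rightarrow> 'a set" where
  "eigenspace A z = {x. A x = z *\<^sub>C x}"

text \<open>The discrete spectrum consists of the isolated points of the spectrum that are eigenvalues of
  finite (geometric) multiplicity. This, and hence \<open>ess_spectrum\<close>, is the usual notion for
  self-adjoint operators only.\<close>

definition discrete_spectrum :: "('a::complex_hilbert_space \<Rightarrow> 'a) \<Rightarrow> complex set" where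
  "discrete_spectrum A =
     {z. z isolated_in spectrum A \<and> eigenspace A z \<noteq> {0} \<and> finite_dim (eigenspace A z)}"

definition ess_spectrum :: "('a::complex_hilbert_space \<Rightarrow> 'a) \<Rightarrow> complex set" where
  "ess_spectrum A = spectrum A - discrete_spectrum A"

definition projection_valued_measure :: "(real set \<Rightarrow> 'a::complex_hilbert_space \<Rightarrow> 'a) \<Rightarrow> bool" where
  "projection_valued_measure E \<longleftrightarrow>
     (\<forall>\<Omega>\<in>sets borel. orthogonal_projection (E \<Omega>)) \<and>
     E UNIV = id \<and>
     (\<forall>F x. range F \<subseteq> sets borel \<and> disjoint_family F \<longrightarrow>
        (\<lambda>n::nat. E (F n) x) sums E (\<Union>n. F n) x)"

text \<open>For a projection-valued measure \<open>E\<close> this is the scalar Borel measure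
  \<open>\<Omega> \<mapsto> \<langle>E(\<Omega>)x, x\<rangle> = \<parallel>E(\<Omega>)x\<parallel>\<^sup>2\<close>.\<close>

definition scalar_measure ::
    "(real set \<Rightarrow> 'a::complex_hilbert_space \<Rightarrow> 'a) \<Rightarrow> 'a \<Rightarrow> real measure" where
  "scalar_measure E x = measure_of UNIV (sets borel) (\<lambda>\<Omega>. ennreal (Re (cinner (E \<Omega> x) x)))"

text \<open>\<open>E\<close> is the spectral measure of the bounded self-adjoint operator \<open>X\<close>, that is
  \<open>X = \<integral> t dE(t)\<close>. The identity is stated for the quadratic forms, which determine a bounded
  operator by polarization. Integrability is required explicitly because the Bochner integral of a
  non-integrable function is \<open>0\<close>.\<close>

definition spectral_measure_of ::
    "('a::complex_hilbert_space \<Rightarrow> 'a) \<Rightarrow> (real set \<Rightarrow> 'a \<Rightarrow> 'a) \<Rightarrow> bool" where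
  "spectral_measure_of X E \<longleftrightarrow> projection_valued_measure E \<and>
     (\<forall>x. integrable (scalar_measure E x) (\<lambda>t. t) \<and>
          cinner (X x) x = complex_of_real (\<integral>t. t \<partial>scalar_measure E x))"

text \<open>\<open>E\<^sub>\<Omega>(X)\<close> for a Borel set \<open>\<Omega>\<close>. The description is of the projection rather than of
  the spectral measure, because the latter is arbitrary outside the Borel sets.\<close>

definition spectral_projection :: "('a::complex_hilbert_space \<Rightarrow> 'a) \<Rightarrow> real set \<Rightarrow> 'a \<Rightarrow> 'a" where
  "spectral_projection X \<Omega> = (THE P. \<exists>E. spectral_measure_of X E \<and> P = E \<Omega>)"

end

theory Submission
  imports Defs "HOL-Probability.Distribution_Functions" "HOL-Computational_Algebra.Polynomial"
begin

text \<open>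
  Put \<open>T' = T + S\<close>. If \<open>R\<close> and \<open>Q\<close> are spectral projections of \<open>T'\<close> and of \<open>T\<close> for sets separated
  by a gap, with one set to the left of the other, then \<open>R Q\<close> is compact (Rosenblum's argument for the
  Sylvester equation). If \<open>\<lambda>\<close> is not in the essential spectrum of \<open>T\<close>, then the spectral
  projection of \<open>T\<close> for a small interval around \<open>\<lambda>\<close> has finite rank, so both terms of
  \<open>D(\<lambda>) = E'(-\<infinity>,\<lambda>) E[\<lambda>,\<infinity>) - E'[\<lambda>,\<infinity>) E(-\<infinity>,\<lambda>)\<close> are compact. If \<open>0\<close> is not in the essential spectrum
  of \<open>D(\<lambda>)\<close>, then a projection \<open>Q\<close> with \<open>D(\<lambda>) Q\<close> compact has finite rank; this applies to
  \<open>E(-\<infinity>,m)\<close> for \<open>m < \<lambda>\<close> and to \<open>E[m,\<infinity>)\<close> for \<open>m > \<lambda>\<close>. Two such points \<open>\<lambda>\<close> would make the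
  identity have finite rank, so in (2) there is at most one exception.

  The spectral theorem behind this rests on \<open>E(-\<infinity>,0) = (J\<^sup>2 - J) / 2\<close>, where \<open>J\<close> is the sign of
  the operator, obtained as a strong limit of polynomials. The projections for arbitrary Borel sets are
  obtained from those for half-lines by a Dynkin argument.
\<close>

section \<open>Real inner product and orthogonal projections\<close>

text \<open>\<open>spectral_projection\<close> is a definite description, so \<open>D\<close>
  acquires a meaning only once existence and uniqueness of the projections are proved. Uniqueness is
  obtained for open half-lines, the sets that occur in \<open>D\<close>, and it comes from order:
  \<open>spec_cut\<close> bounds the quadratic form strictly on the range and weakly on the kernel,
  and no nonzero vector satisfies both bounds.

  The products \<open>R Q\<close> are not self-adjoint, and what is known about them are norm
  estimates. Compactness is therefore carried by the seminorm \<open>norm (A x)\<close>: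
  \<open>precompact\<close> passes through sums, domination and composition with contractions. It
  meets \<open>compact_op\<close> only at the two ends, for \<open>S\<close> and for
  \<open>D lam\<close>.

  The second half of (1) is the finite rank argument with the identity as \<open>Q\<close>: a
  compact \<open>D lam\<close> whose essential spectrum omits 0 would make the whole space
  finite-dimensional.

  Estimates use the real part of the inner product, which is bounded bilinear over the reals;
  compatibility with complex scalars is recorded separately.\<close>

definition rinner :: "'a::complex_hilbert_space \<Rightarrow> 'a \<Rightarrow> real" where
  "rinner x y = Re (cinner x y)"

lemma rinner_commute: "rinner x y = rinner y x"
  unfolding rinner_def by (subst cinner_commute) simp

lemma rinner_self: "rinner x x = (norm x)\<^sup>2"
  unfolding rinner_def by (simp flip: power2_norm_eq_cinner)

lemma rinner_add_left': "rinner (x + y) z = rinner x z + rinner y z"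
  by (simp add: rinner_def cinner_add_left)

lemma rinner_scaleR_left': "rinner (r *\<^sub>R x) z = r * rinner x z"
  unfolding rinner_def by (simp add: cinner_scaleC_left flip: scaleC_of_real)

lemma power2_norm_add: "(norm (x + y))\<^sup>2 = (norm x)\<^sup>2 + 2 * rinner x y + (norm y)\<^sup>2"
  for x y :: "'a::complex_hilbert_space"
proof -
  have "rinner (x + y) (x + y) = rinner x (x + y) + rinner y (x + y)"
    by (rule rinner_add_left')
  also have "\<dots> = rinner (x + y) x + rinner (x + y) y"
    by (simp only: rinner_commute)
  also have "\<dots> = rinner x x + 2 * rinner x y + rinner y y"
    using rinner_commute[of y x] by (simp add: rinner_add_left')
  finally show ?thesis by (simp add: rinner_self)
qed

text \<open>The class provides a norm satisfying the triangle inequality, so Cauchy-Schwarz is read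
  off by squaring that inequality.\<close>

lemma rinner_le_norm: "rinner x y \<le> norm x * norm y"
proof -
  have "(norm (x + y))\<^sup>2 \<le> (norm x + norm y)\<^sup>2"
    by (intro power_mono norm_triangle_ineq) simp
  then show ?thesis
    by (simp add: power2_norm_add) (simp add: power2_eq_square algebra_simps)
qed

lemma abs_rinner_le_norm: "\<bar>rinner x y\<bar> \<le> norm x * norm y"
  using rinner_le_norm[of x y] rinner_le_norm[of "-1 *\<^sub>R x" y]
  unfolding rinner_scaleR_left' by simp

interpretation rinner: bounded_bilinear rinner
proof
  fix a a' b b' :: 'a and r :: real
  show "rinner (a + a') b = rinner a b + rinner a' b"
    by (rule rinner_add_left')
  show "rinner a (b + b') = rinner a b + rinner a b'"
    by (simp add: rinner_commute[of a] rinner_add_left')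
  show "rinner (r *\<^sub>R a) b = r *\<^sub>R rinner a b"
    by (simp add: rinner_scaleR_left')
  show "rinner a (r *\<^sub>R b) = r *\<^sub>R rinner a b"
    by (simp add: rinner_commute[of a] rinner_scaleR_left')
  show "\<exists>K. \<forall>a b :: 'a. norm (rinner a b) \<le> norm a * norm b * K"
    using abs_rinner_le_norm by (intro exI[of _ 1]) auto
qed

lemmas rinner_simps = rinner.add_left rinner.add_right rinner.diff_left rinner.diff_right
  rinner.minus_left rinner.minus_right rinner.scaleR_left rinner.scaleR_right

lemma power2_norm_diff: "(norm (x - y))\<^sup>2 = (norm x)\<^sup>2 - 2 * rinner x y + (norm y)\<^sup>2"
  for x y :: "'a::complex_hilbert_space"
  using power2_norm_add[of x "-y"] by (simp add: rinner_simps)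

lemma rinner_eqI: "(\<And>z. rinner x z = rinner y z) \<Longrightarrow> x = y"
  using rinner_self[of "x - y"] by (simp add: rinner_simps)

lemma cinner_scaleC_right: "cinner x (c *\<^sub>C y) = cnj c * cinner x y"
  by (metis cinner_commute cinner_scaleC_left complex_cnj_mult)

lemma cinner_eq_rinner: "cinner x y = Complex (rinner x y) (rinner x (\<i> *\<^sub>C y))"
  by (simp add: complex_eq_iff rinner_def cinner_scaleC_right)

lemma norm_scaleC: "norm (c *\<^sub>C x) = cmod c * norm (x::'a::complex_hilbert_space)"
proof -
  have "complex_of_real ((norm (c *\<^sub>C x))\<^sup>2) = complex_of_real ((cmod c * norm x)\<^sup>2)"
    unfolding power2_norm_eq_cinner cinner_scaleC_left cinner_scaleC_right power_mult_distrib of_real_mult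
    using complex_norm_square[of c] by (simp add: mult_ac)
  then show ?thesis
    by (metis norm_ge_zero mult_nonneg_nonneg of_real_eq_iff power2_eq_imp_eq)
qed

lemma linear_scaleC_iff:
  "Vector_Spaces.linear scaleC scaleC A \<longleftrightarrow>
     (\<forall>x y. A (x + y) = A x + A y) \<and> (\<forall>c x. A (c *\<^sub>C x) = c *\<^sub>C A x)"
  for A :: "'a::complex_hilbert_space \<Rightarrow> 'a"
  using complex_vector.vector_space_axioms[where 'a='a] unfolding Vector_Spaces.linear_iff by blast

lemma bounded_op_iff: "bounded_op A \<longleftrightarrow> bounded_linear A \<and> (\<forall>c x. A (c *\<^sub>C x) = c *\<^sub>C A x)"
proof
  assume A: "bounded_op A"
  then obtain K where K: "\<And>x. norm (A x) \<le> K * norm x"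
    by (auto simp: bounded_op_def)
  have add: "\<And>x y. A (x + y) = A x + A y" and sc: "\<And>c x. A (c *\<^sub>C x) = c *\<^sub>C A x"
    using A by (auto simp: bounded_op_def linear_scaleC_iff)
  have "bounded_linear A"
    by (rule bounded_linear_intro[where K=K])
       (use add sc[of "complex_of_real _"] K in \<open>auto simp: scaleC_of_real mult.commute\<close>)
  with sc show "bounded_linear A \<and> (\<forall>c x. A (c *\<^sub>C x) = c *\<^sub>C A x)" by blast
next
  assume A: "bounded_linear A \<and> (\<forall>c x. A (c *\<^sub>C x) = c *\<^sub>C A x)"
  then obtain K where "\<And>x. norm (A x) \<le> norm x * K"
    using bounded_linear.bounded by blast
  with A show "bounded_op A"
    unfolding bounded_op_def linear_scaleC_iff
    by (auto simp: bounded_linear_def linear_add mult.commute)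
qed

text \<open>The imaginary part of the inner product is the real part taken against
  \<open>\<i> *\<^sub>C y\<close>. For a complex linear map, symmetry of the real part therefore
  gives full symmetry.\<close>

lemma self_adjoint_iff:
  "self_adjoint A \<longleftrightarrow> bounded_linear A \<and> (\<forall>c x. A (c *\<^sub>C x) = c *\<^sub>C A x) \<and>
     (\<forall>x y. rinner (A x) y = rinner x (A y))"
proof -
  have "(\<forall>x y. cinner (A x) y = cinner x (A y)) \<longleftrightarrow> (\<forall>x y. rinner (A x) y = rinner x (A y))"
    if "\<forall>c x. A (c *\<^sub>C x) = c *\<^sub>C A x"
  proof
    assume "\<forall>x y. rinner (A x) y = rinner x (A y)"
    then show "\<forall>x y. cinner (A x) y = cinner x (A y)"
      using that by (metis cinner_eq_rinner)
  qed (simp add: rinner_def)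
  then show ?thesis
    unfolding self_adjoint_def bounded_op_iff by blast
qed

lemma self_adjointD:
  assumes "self_adjoint A"
  shows self_adjoint_bounded_linear: "bounded_linear A"
    and self_adjoint_scaleC: "A (c *\<^sub>C x) = c *\<^sub>C A x"
    and self_adjoint_rinner: "rinner (A x) y = rinner x (A y)"
    and self_adjoint_add: "A (x + y) = A x + A y"
    and self_adjoint_diff: "A (x - y) = A x - A y"
    and self_adjoint_zero: "A 0 = 0"
    and self_adjoint_scaleR: "A (r *\<^sub>R x) = r *\<^sub>R A x"
proof -
  show b: "bounded_linear A" and "A (c *\<^sub>C x) = c *\<^sub>C A x" "rinner (A x) y = rinner x (A y)"
    using assms by (auto simp: self_adjoint_iff)
  then interpret bounded_linear A by simp
  show "A (x + y) = A x + A y" "A (x - y) = A x - A y" "A 0 = 0" "A (r *\<^sub>R x) = r *\<^sub>R A x"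
    by (auto simp: add diff scaleR)
qed

lemma scaleC_scaleR_commute: "c *\<^sub>C r *\<^sub>R x = r *\<^sub>R c *\<^sub>C (x::'a::complex_hilbert_space)"
  by (simp add: scaleC_scaleC mult.commute flip: scaleC_of_real)

lemma bounded_linear_scaleC: "bounded_linear (scaleC c :: 'a::complex_hilbert_space \<Rightarrow> 'a)"
  by (rule bounded_linear_intro[where K="cmod c"])
     (auto simp: scaleC_add_right scaleC_scaleR_commute norm_scaleC)

lemma self_adjoint_comb:
  assumes A: "self_adjoint A" and B: "self_adjoint B"
  shows "self_adjoint (\<lambda>x. a *\<^sub>R A x + b *\<^sub>R B x)"
  unfolding self_adjoint_iff
  using self_adjointD[OF A] self_adjointD[OF B]
  by (auto simp: rinner_simps scaleC_add_right scaleC_scaleR_commute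
      intro!: bounded_linear_add bounded_linear_const_scaleR)

lemma self_adjoint_compose:
  assumes A: "self_adjoint A" and B: "self_adjoint B" and "\<And>x. A (B x) = B (A x)"
  shows "self_adjoint (\<lambda>x. A (B x))"
  unfolding self_adjoint_iff
proof (intro conjI allI)
  show "bounded_linear (\<lambda>x. A (B x))"
    using bounded_linear_compose[OF A[THEN self_adjoint_bounded_linear] B[THEN self_adjoint_bounded_linear]] .
  show "\<And>c x. A (B (c *\<^sub>C x)) = c *\<^sub>C A (B x)"
    using A B by (simp add: self_adjoint_scaleC)
  show "\<And>x y. rinner (A (B x)) y = rinner x (A (B y))"
    using self_adjoint_rinner[OF A] self_adjoint_rinner[OF B] assms(3) by metis
qed

lemma self_adjoint_id: "self_adjoint (\<lambda>x. x)"
  by (simp add: self_adjoint_iff bounded_linear_ident)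

lemma self_adjoint_plus: "self_adjoint A \<Longrightarrow> self_adjoint B \<Longrightarrow> self_adjoint (\<lambda>x. A x + B x)"
  using self_adjoint_comb[of A B 1 1] by simp

lemma self_adjoint_minus: "self_adjoint A \<Longrightarrow> self_adjoint B \<Longrightarrow> self_adjoint (\<lambda>x. A x - B x)"
  using self_adjoint_comb[of A B 1 "-1"] by simp

lemma self_adjoint_uminus: "self_adjoint A \<Longrightarrow> self_adjoint (\<lambda>x. - A x)"
  using self_adjoint_comb[of A A "-1" 0] by simp

lemma self_adjoint_shift: "self_adjoint A \<Longrightarrow> self_adjoint (\<lambda>x. A x - c *\<^sub>R x)"
  using self_adjoint_comb[of A "\<lambda>x. x" 1 "-c"] self_adjoint_id by simp

lemma self_adjoint_bound:
  assumes "self_adjoint A"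
  obtains K where "K > 0" "\<And>x. norm (A x) \<le> K * norm x"
  using bounded_linear.pos_bounded[OF self_adjoint_bounded_linear[OF assms]]
  by (metis mult.commute)

lemma orthogonal_projection_iff:
  "orthogonal_projection P \<longleftrightarrow> self_adjoint P \<and> (\<forall>x. P (P x) = P x)"
  by (auto simp: orthogonal_projection_def fun_eq_iff)

lemma
  assumes "orthogonal_projection P"
  shows oproj_self_adjoint: "self_adjoint P"
    and oproj_idem: "P (P x) = P x"
    and oproj_rinner: "rinner (P x) x = (norm (P x))\<^sup>2"
    and oproj_orth: "rinner (P x) (y - P y) = 0"
    and oproj_pythagoras: "(norm x)\<^sup>2 = (norm (P x))\<^sup>2 + (norm (x - P x))\<^sup>2"
    and oproj_norm_le: "norm (P x) \<le> norm x"
    and oproj_compl_norm_le: "norm (x - P x) \<le> norm x"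
    and oproj_compl: "orthogonal_projection (\<lambda>x. x - P x)"
proof -
  show P: "self_adjoint P" and idem: "P (P x) = P x" for x
    using assms by (auto simp: orthogonal_projection_iff)
  show 1: "rinner (P x) x = (norm (P x))\<^sup>2" for x
    using self_adjoint_rinner[OF P, of "P x" x] by (simp add: idem flip: rinner_self)
  show orth: "rinner (P x) (y - P y) = 0" for x y
    using self_adjoint_rinner[OF P, of "x" "P y"] self_adjoint_rinner[OF P, of "x" "y"]
    by (simp add: idem rinner_simps)
  show 2: "(norm x)\<^sup>2 = (norm (P x))\<^sup>2 + (norm (x - P x))\<^sup>2"
    using power2_norm_add[of "P x" "x - P x"] orth[of x x] by simp
  have "(norm (P x))\<^sup>2 \<le> (norm x)\<^sup>2" "(norm (x - P x))\<^sup>2 \<le> (norm x)\<^sup>2"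
    unfolding 2 by auto
  then show "norm (P x) \<le> norm x" "norm (x - P x) \<le> norm x"
    by (auto intro: power2_le_imp_le)
  show "orthogonal_projection (\<lambda>x. x - P x)"
    unfolding orthogonal_projection_iff
    using self_adjoint_minus[OF self_adjoint_id P] by (auto simp: idem self_adjoint_diff[OF P])
qed

lemma oproj_zero: "orthogonal_projection (\<lambda>x. 0)"
  using oproj_compl[of "\<lambda>x. x"] by (auto simp: orthogonal_projection_iff self_adjoint_id)

lemma oproj_id: "orthogonal_projection (\<lambda>x. x)"
  by (auto simp: orthogonal_projection_iff self_adjoint_id)

text \<open>Testing at \<open>x - P x\<close> shows that \<open>R\<close> kills the kernel of
  \<open>P\<close>; testing at \<open>P x\<close> shows, by Pythagoras, that \<open>R\<close> fixes
  the range of \<open>P\<close>.\<close>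

lemma oproj_eqI:
  assumes P: "orthogonal_projection P" and R: "orthogonal_projection R"
    and eq: "\<And>x. rinner (P x) x = rinner (R x) x"
  shows "P = R"
proof
  fix x
  have "norm (R (x - P x)) = 0"
    using eq[of "x - P x"]
    unfolding oproj_rinner[OF P] oproj_rinner[OF R] self_adjoint_diff[OF oproj_self_adjoint[OF P]]
      oproj_idem[OF P] by (simp add: rinner.zero_left)
  moreover have "norm (P x - R (P x)) = 0"
    using eq[of "P x"] oproj_pythagoras[OF R, of "P x"]
    unfolding oproj_rinner[OF P] oproj_rinner[OF R] oproj_idem[OF P] by (simp add: rinner_self)
  ultimately show "P x = R x"
    by (simp add: self_adjointD[OF oproj_self_adjoint[OF R]])
qed

text \<open>An invariant subspace of a self-adjoint operator reduces it: take adjoints in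
  \<open>P A P = A P\<close>.\<close>

lemma oproj_commuteI:
  assumes P: "orthogonal_projection P" and A: "self_adjoint A"
    and inv: "\<And>x. P (A (P x)) = A (P x)"
  shows "A (P x) = P (A x)"
proof (rule rinner_eqI)
  note saP = oproj_self_adjoint[OF P]
  fix z
  have "rinner (A (P x)) z = rinner (P (A (P x))) z"
    by (simp add: inv)
  also have "\<dots> = rinner x (P (A (P z)))"
    by (simp add: self_adjoint_rinner[OF saP] self_adjoint_rinner[OF A])
  also have "\<dots> = rinner (P (A x)) z"
    by (simp add: inv self_adjoint_rinner[OF saP] self_adjoint_rinner[OF A])
  finally show "rinner (A (P x)) z = rinner (P (A x)) z" .
qed

text \<open>The hypothesis forces \<open>g\<close> to increase, so \<open>g\<close> is Cauchy and
  hands this on to \<open>f\<close>. In the applications \<open>g\<close> is the squared norm of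
  \<open>f\<close>, for increasing projections and for the sign iteration.\<close>

lemma convergent_if_norm_diff_le:
  fixes f :: "nat \<Rightarrow> 'a::complex_hilbert_space"
  assumes le: "\<And>m n. m \<le> n \<Longrightarrow> (norm (f n - f m))\<^sup>2 \<le> g n - g m"
    and bd: "\<And>n. g n \<le> B"
  shows "convergent f"
proof -
  have "incseq g"
  proof (rule incseq_SucI)
    fix n show "g n \<le> g (Suc n)"
      using le[of n "Suc n"] zero_le_power2[of "norm (f (Suc n) - f n)"] by linarith
  qed
  then obtain L where "g \<longlonglongrightarrow> L"
    using bd incseq_convergent[of g B] by metis
  then have cg: "Cauchy g" by (rule LIMSEQ_imp_Cauchy)
  have "Cauchy f"
    unfolding Cauchy_altdef2
  proof (intro allI impI)
    fix e :: real assume e: "e > 0"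
    then obtain N where N: "\<And>n. n \<ge> N \<Longrightarrow> dist (g n) (g N) < e\<^sup>2"
      using cg unfolding Cauchy_altdef2 by (meson zero_less_power)
    have "dist (f n) (f N) < e" if "n \<ge> N" for n
    proof (rule power2_less_imp_less)
      show "(dist (f n) (f N))\<^sup>2 < e\<^sup>2"
        using N[OF that] le[OF that] by (auto simp: dist_norm)
    qed (use e in simp)
    then show "\<exists>N. \<forall>n\<ge>N. dist (f n) (f N) < e" by blast
  qed
  then show ?thesis by (simp add: Cauchy_convergent_iff)
qed

text \<open>Composition is jointly continuous for strong limits of contractions. This carries
  polynomial identities such as idempotence to the limit.\<close>

lemma tendsto_contractions_apply:
  fixes F :: "nat \<Rightarrow> 'a::real_normed_vector \<Rightarrow> 'b::real_normed_vector"
  assumes lin: "\<And>n. bounded_linear (F n)" and contr: "\<And>n x. norm (F n x) \<le> norm x"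
    and lim: "\<And>x. (\<lambda>n. F n x) \<longlonglongrightarrow> G x" and y: "y \<longlonglongrightarrow> z"
  shows "(\<lambda>n. F n (y n)) \<longlonglongrightarrow> G z"
proof -
  have "(\<lambda>n. F n (y n - z)) \<longlonglongrightarrow> 0"
  proof (rule Lim_null_comparison)
    show "\<forall>\<^sub>F n in sequentially. norm (F n (y n - z)) \<le> norm (y n - z)"
      by (simp add: contr)
    show "(\<lambda>n. norm (y n - z)) \<longlonglongrightarrow> 0"
      using y by (metis LIM_zero tendsto_norm_zero)
  qed
  from tendsto_add[OF this lim[of z]] show ?thesis
    by (simp add: bounded_linear.linear[OF lin] linear_diff)
qed

lemma self_adjoint_strong_limit:
  fixes F :: "nat \<Rightarrow> 'a::complex_hilbert_space \<Rightarrow> 'a"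
  assumes sa: "\<And>n. self_adjoint (F n)" and contr: "\<And>n x. norm (F n x) \<le> norm x"
    and lim: "\<And>x. (\<lambda>n. F n x) \<longlonglongrightarrow> G x"
  shows "self_adjoint G" and "norm (G x) \<le> norm x"
proof -
  show le: "norm (G x) \<le> norm x" for x
    by (rule LIMSEQ_le_const2[OF tendsto_norm[OF lim[of x]]]) (use contr in auto)
  have add: "G (x + y) = G x + G y" for x y
    using lim[of "x + y"] tendsto_add[OF lim[of x] lim[of y]]
    by (simp add: self_adjointD[OF sa] LIMSEQ_unique)
  have sc: "G (c *\<^sub>C x) = c *\<^sub>C G x" for c x
    using lim[of "c *\<^sub>C x"] bounded_linear.tendsto[OF bounded_linear_scaleC lim[of x], of c]
    by (simp add: self_adjointD[OF sa] LIMSEQ_unique)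
  have sr: "G (r *\<^sub>R x) = r *\<^sub>R G x" for r x
    using sc[of "complex_of_real r" x] by (simp add: scaleC_of_real)
  have "bounded_linear G"
    by (rule bounded_linear_intro[where K=1]) (use add sr le in auto)
  moreover have "rinner (G x) y = rinner x (G y)" for x y
    using rinner.tendsto[OF lim[of x] tendsto_const[of y]]
      rinner.tendsto[OF tendsto_const[of x] lim[of y]]
    by (simp add: self_adjointD[OF sa] LIMSEQ_unique)
  ultimately show "self_adjoint G"
    using sc by (simp add: self_adjoint_iff)
qed

lemma oproj_strong_limit:
  fixes F :: "nat \<Rightarrow> 'a::complex_hilbert_space \<Rightarrow> 'a"
  assumes P: "\<And>n. orthogonal_projection (F n)" and lim: "\<And>x. (\<lambda>n. F n x) \<longlonglongrightarrow> G x"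
  shows "orthogonal_projection G"
proof -
  note sa = oproj_self_adjoint[OF P] and le = oproj_norm_le[OF P]
  have "G (G x) = G x" for x
    using tendsto_contractions_apply[OF self_adjoint_bounded_linear[OF sa] le lim lim[of x]]
      lim[of x] by (simp add: oproj_idem[OF P] LIMSEQ_unique)
  then show ?thesis
    using self_adjoint_strong_limit(1)[OF sa le lim] by (simp add: orthogonal_projection_iff)
qed

lemma oproj_add:
  assumes P: "orthogonal_projection P" and R: "orthogonal_projection R"
    and orth: "\<And>x. P (R x) = 0"
  shows "orthogonal_projection (\<lambda>x. P x + R x)"
proof -
  note saP = self_adjointD[OF oproj_self_adjoint[OF P]] and saR = self_adjointD[OF oproj_self_adjoint[OF R]]
  have "R (P x) = 0" for x
    by (rule rinner_eqI) (simp add: saP saR orth rinner.zero_left rinner.zero_right)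
  then show ?thesis
    unfolding orthogonal_projection_iff
    using self_adjoint_plus[OF oproj_self_adjoint[OF P] oproj_self_adjoint[OF R]]
    by (auto simp: saP saR oproj_idem[OF P] oproj_idem[OF R] orth)
qed

lemma oproj_incseq_strong_limit:
  fixes F :: "nat \<Rightarrow> 'a::complex_hilbert_space \<Rightarrow> 'a"
  assumes P: "\<And>n. orthogonal_projection (F n)"
    and mono: "\<And>m n x. m \<le> n \<Longrightarrow> F n (F m x) = F m x"
  obtains G where "orthogonal_projection G" "\<And>x. (\<lambda>n. F n x) \<longlonglongrightarrow> G x"
proof -
  have "convergent (\<lambda>n. F n x)" for x
  proof (rule convergent_if_norm_diff_le[where g="\<lambda>n. (norm (F n x))\<^sup>2" and B="(norm x)\<^sup>2"])
    fix m n :: nat assume "m \<le> n"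
    have "rinner (F n x) (F m x) = rinner x (F m x)"
      unfolding self_adjoint_rinner[OF oproj_self_adjoint[OF P]] mono[OF \<open>m \<le> n\<close>] ..
    also have "\<dots> = (norm (F m x))\<^sup>2"
      unfolding rinner_commute[of x] by (rule oproj_rinner[OF P])
    finally have "rinner (F n x) (F m x) = (norm (F m x))\<^sup>2" .
    then show "(norm (F n x - F m x))\<^sup>2 \<le> (norm (F n x))\<^sup>2 - (norm (F m x))\<^sup>2"
      by (simp add: power2_norm_diff)
  qed (simp add: oproj_norm_le[OF P] power_mono)
  then have lim: "(\<lambda>n. F n x) \<longlonglongrightarrow> lim (\<lambda>n. F n x)" for x
    by (simp add: convergent_LIMSEQ_iff)
  from that[OF oproj_strong_limit[OF P this] this] show ?thesis .
qed

lemma oproj_sums: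
  fixes P :: "nat \<Rightarrow> 'a::complex_hilbert_space \<Rightarrow> 'a"
  assumes P: "\<And>n. orthogonal_projection (P n)"
    and orth: "\<And>m n x. m \<noteq> n \<Longrightarrow> P m (P n x) = 0"
  obtains G where "orthogonal_projection G" "\<And>x. (\<lambda>n. P n x) sums G x"
proof -
  note saP = self_adjointD[OF oproj_self_adjoint[OF P]]
  define S where "S n x = (\<Sum>i<n. P i x)" for n x
  have S_orth: "P m (S n x) = (if m < n then P m x else 0)" for m n x
    by (induction n) (auto simp: S_def saP oproj_idem[OF P] orth less_Suc_eq)
  have S_orth': "S n (P m x) = (if m < n then P m x else 0)" for m n x
    by (induction n) (auto simp: S_def saP oproj_idem[OF P] orth less_Suc_eq)
  have PS: "orthogonal_projection (S n)" for n
  proof (induction n)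
    case 0
    have "S 0 = (\<lambda>x. 0)" by (auto simp: S_def)
    then show ?case by (simp add: oproj_zero)
  next
    case (Suc n)
    have "S (Suc n) = (\<lambda>x. S n x + P n x)" by (auto simp: S_def)
    with oproj_add[OF Suc P[of n]] S_orth' show ?case by simp
  qed
  have mono: "S n (S m x) = S m x" if "m \<le> n" for m n x
  proof -
    have "S n (S m x) = (\<Sum>i<m. S n (P i x))"
      unfolding S_def[of m] using linear_sum[OF bounded_linear.linear[OF self_adjoint_bounded_linear[OF oproj_self_adjoint[OF PS]]]]
      by blast
    also have "\<dots> = S m x"
      unfolding S_def[of m] using that by (auto simp: S_orth' intro!: sum.cong)
    finally show ?thesis .
  qed
  show ?thesis
  proof (rule oproj_incseq_strong_limit[OF PS mono])
    fix G assume "orthogonal_projection G" "\<And>x. (\<lambda>n. S n x) \<longlonglongrightarrow> G x"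
    then show ?thesis unfolding S_def by (intro that) (auto simp: sums_def)
  qed
qed

section \<open>Polynomials of an operator\<close>

text \<open>Horner's scheme, by the same kind of fold as \<open>poly\<close>, so that induction over
  \<open>pCons\<close> yields the laws of a ring homomorphism.\<close>

definition poly_op :: "('a::real_vector \<Rightarrow> 'a) \<Rightarrow> real poly \<Rightarrow> 'a \<Rightarrow> 'a" where
  "poly_op A p = fold_coeffs (\<lambda>a f x. a *\<^sub>R x + A (f x)) p (\<lambda>x. 0)"

lemma poly_op_0 [simp]: "poly_op A 0 x = 0"
  by (simp add: poly_op_def)

lemma poly_op_pCons: "linear A \<Longrightarrow> poly_op A (pCons a p) x = a *\<^sub>R x + A (poly_op A p x)"
  by (cases "p = 0 \<and> a = 0") (auto simp: poly_op_def linear_0)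

lemma poly_op_add: "linear A \<Longrightarrow> poly_op A (p + q) x = poly_op A p x + poly_op A q x"
  by (induction p q rule: poly_induct2)
     (simp_all add: poly_op_pCons linear_add scaleR_left_distrib)

lemma poly_op_smult: "linear A \<Longrightarrow> poly_op A (smult c p) x = c *\<^sub>R poly_op A p x"
  by (induction p) (simp_all add: poly_op_pCons linear_scale scaleR_right_distrib)

lemma poly_op_diff: "linear A \<Longrightarrow> poly_op A (p - q) x = poly_op A p x - poly_op A q x"
  using poly_op_add[of A "p - q" q x] by simp

lemma poly_op_mult: "linear A \<Longrightarrow> poly_op A (p * q) x = poly_op A p (poly_op A q x)"
  by (induction p) (simp_all add: poly_op_pCons poly_op_add poly_op_smult)

lemma poly_op_1: "linear A \<Longrightarrow> poly_op A 1 x = x"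
  by (simp add: one_pCons poly_op_pCons linear_0)

lemma poly_op_X: "linear A \<Longrightarrow> poly_op A [:0, 1:] x = A x"
  by (simp add: poly_op_pCons linear_0)

lemmas poly_op_simps = poly_op_add poly_op_smult poly_op_diff poly_op_mult poly_op_1 poly_op_X

lemma poly_op_commute:
  assumes "linear A" "linear Z" and "\<And>x. Z (A x) = A (Z x)"
  shows "Z (poly_op A p x) = poly_op A p (Z x)"
  by (induction p) (use assms in \<open>simp_all add: poly_op_pCons linear_add linear_scale linear_0\<close>)

lemma self_adjoint_poly_op:
  assumes A: "self_adjoint A"
  shows "self_adjoint (poly_op A p)"
proof (induction p)
  case 0
  have "poly_op A 0 = (\<lambda>x. 0)" by auto
  then show ?case using oproj_self_adjoint[OF oproj_zero] by simp
next
  case (pCons a p)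
  have lin: "linear A"
    using A by (simp add: self_adjoint_bounded_linear bounded_linear.linear)
  have "poly_op A (pCons a p) = (\<lambda>x. a *\<^sub>R x + 1 *\<^sub>R A (poly_op A p x))"
    by (simp add: fun_eq_iff poly_op_pCons lin)
  with self_adjoint_comb[OF self_adjoint_id self_adjoint_compose[OF A pCons(2)], of a 1]
  show ?case by (simp add: poly_op_commute lin)
qed

text \<open>The quadratic module generated by \<open>1 - X\<^sup>2\<close>. It is closed under multiplication, and it
  gives positive operators when evaluated at a self-adjoint contraction.\<close>

inductive_set pos_cone :: "real poly set" where
  zero: "0 \<in> pos_cone"
| sq: "q \<in> pos_cone \<Longrightarrow> q + p * p \<in> pos_cone"
| sqw: "q \<in> pos_cone \<Longrightarrow> q + p * p * (1 - [:0, 1:] * [:0, 1:]) \<in> pos_cone"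

lemma pos_cone_add: "q \<in> pos_cone \<Longrightarrow> p \<in> pos_cone \<Longrightarrow> p + q \<in> pos_cone"
  by (induction q rule: pos_cone.induct)
     (simp_all only: pos_cone.intros add_0_right flip: add.assoc)

lemma pos_cone_mult_sq: "q \<in> pos_cone \<Longrightarrow> q * (r * r) \<in> pos_cone"
proof (induction q rule: pos_cone.induct)
  case (sq q p)
  have "(q + p * p) * (r * r) = q * (r * r) + (p * r) * (p * r)"
    by (simp only: algebra_simps)
  with pos_cone.sq[OF sq.IH] show ?case by metis
next
  case (sqw q p)
  have "(q + p * p * (1 - [:0, 1:] * [:0, 1:])) * (r * r)
      = q * (r * r) + (p * r) * (p * r) * (1 - [:0, 1:] * [:0, 1:])"
    by (simp only: algebra_simps)
  with pos_cone.sqw[OF sqw.IH] show ?case by metis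
qed (simp add: pos_cone.zero)

text \<open>With \<open>w\<close> for the weight \<open>1 - X^2\<close>, two weights merge into a
  square: the product of \<open>p * p * w\<close> and \<open>r * r * w\<close> is the square of
  \<open>p * r * w\<close>.\<close>

lemma pos_cone_mult_sqw: "q \<in> pos_cone \<Longrightarrow> q * (r * r * (1 - [:0, 1:] * [:0, 1:])) \<in> pos_cone"
proof (induction q rule: pos_cone.induct)
  case (sq q p)
  have "(q + p * p) * (r * r * (1 - [:0, 1:] * [:0, 1:]))
      = q * (r * r * (1 - [:0, 1:] * [:0, 1:])) + (p * r) * (p * r) * (1 - [:0, 1:] * [:0, 1:])"
    by (simp only: algebra_simps)
  with pos_cone.sqw[OF sq.IH] show ?case by metis
next
  case (sqw q p)
  define w :: "real poly" where "w = 1 - [:0, 1:] * [:0, 1:]"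
  have "(q + p * p * w) * (r * r * w) = q * (r * r * w) + (p * r * w) * (p * r * w)"
    by (simp only: algebra_simps)
  with pos_cone.sq[OF sqw.IH] show ?case by (metis w_def)
qed (simp add: pos_cone.zero)

lemma pos_cone_mult: "q \<in> pos_cone \<Longrightarrow> p \<in> pos_cone \<Longrightarrow> p * q \<in> pos_cone"
proof (induction q rule: pos_cone.induct)
  case (sq q r)
  then show ?case
    using pos_cone_add pos_cone_mult_sq by (metis distrib_left)
next
  case (sqw q r)
  then show ?case
    using pos_cone_add pos_cone_mult_sqw by (metis distrib_left)
qed (simp add: pos_cone.zero)

lemma pos_cone_sq: "p * p \<in> pos_cone"
  using pos_cone.sq[OF pos_cone.zero, of p] by simp

lemma pos_cone_smult: "c \<ge> 0 \<Longrightarrow> p \<in> pos_cone \<Longrightarrow> smult c p \<in> pos_cone"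
  using pos_cone_mult_sq[of p "[:sqrt c:]"] by (simp add: mult.commute)

lemma pos_cone_1: "1 \<in> pos_cone"
  using pos_cone_sq[of 1] by simp

lemmas pos_cone_intros = pos_cone.zero pos_cone_add pos_cone_mult pos_cone_sq pos_cone_smult pos_cone_1

lemma pos_cone_nonneg:
  assumes A: "self_adjoint A" and contr: "\<And>x. norm (A x) \<le> norm x" and q: "q \<in> pos_cone"
  shows "0 \<le> rinner (poly_op A q x) x"
  using q
proof induction
  case zero
  then show ?case by (simp add: rinner.zero_left)
next
  note lin[simp] = bounded_linear.linear[OF self_adjoint_bounded_linear[OF A]]
  {
    case (sq q p)
    have "rinner (poly_op A (p * p) x) x = (norm (poly_op A p x))\<^sup>2"
      by (simp add: poly_op_mult self_adjoint_rinner[OF self_adjoint_poly_op[OF A]] rinner_self)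
    with sq show ?case by (simp add: poly_op_add rinner.add_left)
  next
    case (sqw q p)
    define y where "y = poly_op A p x"
    have "p * p * (1 - [:0, 1:] * [:0, 1:]) = p * ((1 - [:0, 1:] * [:0, 1:]) * p)"
      by (simp only: mult_ac)
    then have "rinner (poly_op A (p * p * (1 - [:0, 1:] * [:0, 1:])) x) x = rinner (y - A (A y)) y"
      by (simp only: poly_op_simps lin self_adjoint_rinner[OF self_adjoint_poly_op[OF A]] y_def)
    also have "\<dots> = (norm y)\<^sup>2 - (norm (A y))\<^sup>2"
      by (simp add: rinner.diff_left self_adjoint_rinner[OF A] rinner_self)
    also have "\<dots> \<ge> 0"
      by (simp add: contr power_mono)
    finally show ?case using sqw by (simp add: poly_op_add rinner.add_left)
  }
qed

text \<open>The Newton--Schulz iteration, which converges to the sign function on \<open>[-1, 1]\<close>.\<close>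

primrec sgn_iter :: "nat \<Rightarrow> real poly" where
  "sgn_iter 0 = [:0, 1:]"
| "sgn_iter (Suc n) = sgn_iter n + smult (1/2) (sgn_iter n * (1 - sgn_iter n * sgn_iter n))"

text \<open>If \<open>d = 1 - a * a\<close> is the defect of one iterate, the defect of the next is
  \<open>(3 * d^2 + d^3) / 4\<close>, which stays in the cone because the cone is multiplicative.
  Evaluated at a contraction, this says that every iterate is again a contraction.\<close>

lemma sgn_iter_contr: "1 - sgn_iter n * sgn_iter n \<in> pos_cone"
proof (induction n)
  case 0
  show ?case using pos_cone.sqw[OF pos_cone.zero, of 1] by simp
next
  case (Suc n)
  define a where "a = sgn_iter n"
  define d where "d = 1 - a * a"
  have *: "smult 4 (1 - (a + smult (1/2) (a * d)) * (a + smult (1/2) (a * d)))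
      = smult 3 (d * d) + d * (d * d)"
  proof -
    have "smult 2 (a + smult (1/2) (a * d)) = smult 2 a + a * d"
      by (simp add: smult_add_right)
    moreover have "smult 4 (p * p) = smult 2 p * smult 2 p" for p :: "real poly"
      by simp
    ultimately have "smult 4 ((a + smult (1/2) (a * d)) * (a + smult (1/2) (a * d)))
      = (smult 2 a + a * d) * (smult 2 a + a * d)"
      by metis
    also have "\<dots> = smult 4 1 - (smult 3 (d * d) + d * (d * d))"
    proof -
      have *: "smult (numeral k) p = numeral k * p" for k and p :: "real poly"
        by (simp add: numeral_poly)
      show ?thesis
        unfolding d_def * by (simp add: algebra_simps)
    qed
    finally show ?thesis by (simp add: smult_diff_right)
  qed
  have "smult 3 (d * d) + d * (d * d) \<in> pos_cone"
    using Suc by (intro pos_cone_intros) (auto simp: a_def d_def)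
  then have "smult (1/4) (smult 4 (1 - (a + smult (1/2) (a * d)) * (a + smult (1/2) (a * d)))) \<in> pos_cone"
    unfolding * by (intro pos_cone_smult) auto
  then show ?case by (simp add: a_def d_def)
qed

text \<open>One step multiplies by \<open>1 + d / 2\<close> with the defect \<open>d\<close> in the
  cone, and such factors multiply to \<open>1 + v\<close>. Hence the product of iterates
  \<open>m\<close> and \<open>n\<close> dominates the square of iterate \<open>m\<close>, and every
  iterate is a multiple of \<open>X\<close>.\<close>

lemma sgn_iter_factor:
  assumes "m \<le> n"
  obtains v where "v \<in> pos_cone" "sgn_iter n = sgn_iter m + sgn_iter m * v"
proof -
  have "\<exists>v\<in>pos_cone. sgn_iter n = sgn_iter m + sgn_iter m * v"
    using assms
  proof (induction n rule: dec_induct)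
    case base
    show ?case using pos_cone.zero by force
  next
    case (step n)
    then obtain v where v: "v \<in> pos_cone" "sgn_iter n = sgn_iter m + sgn_iter m * v" by blast
    define w where "w = smult (1/2) (1 - sgn_iter n * sgn_iter n)"
    have w: "w \<in> pos_cone"
      unfolding w_def by (intro pos_cone_smult sgn_iter_contr) auto
    have "sgn_iter (Suc n) = sgn_iter n + sgn_iter n * w"
      by (simp add: w_def)
    also have "\<dots> = sgn_iter m + sgn_iter m * (v + w + v * w)"
      unfolding v by (simp add: algebra_simps)
    finally show ?case
      using v w by (intro bexI[of _ "v + w + v * w"] pos_cone_intros)
  qed
  with that show ?thesis by blast
qed

section \<open>Sign of a self-adjoint operator\<close>

text \<open>The iterates need not converge in operator norm when the spectrum accumulates at 0, but
  they converge strongly: \<open>F_mono\<close> bounds the squared distance of two iterates by the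
  difference of their squared norms. The limit of the recursion gives \<open>J^3 = J\<close>;
  comparison with the first iterate, which is \<open>A\<close>, gives the form bound; and
  commutation with \<open>A\<close> is inherited from polynomials.\<close>

lemma sign_operator:
  fixes A :: "'a::complex_hilbert_space \<Rightarrow> 'a"
  assumes A: "self_adjoint A" and contr: "\<And>x. norm (A x) \<le> norm x"
  obtains J where "self_adjoint J" "\<And>x. J (J (J x)) = J x" "\<And>x. (norm (A x))\<^sup>2 \<le> rinner (A (J x)) x"
    "\<And>x. A x = 0 \<longleftrightarrow> J x = 0"
    "\<forall>Z. bounded_linear Z \<longrightarrow> (\<forall>x. Z (A x) = A (Z x)) \<longrightarrow> (\<forall>x. Z (J x) = J (Z x))"
proof -
  note lin[simp] = bounded_linear.linear[OF self_adjoint_bounded_linear[OF A]]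
  define F where "F n = poly_op A (sgn_iter n)" for n
  have sa: "self_adjoint (F n)" for n
    unfolding F_def by (rule self_adjoint_poly_op[OF A])
  note pos = pos_cone_nonneg[OF A contr]
  have sq: "rinner (poly_op A (sgn_iter m * sgn_iter n) x) y = rinner (F n x) (F m y)" for m n x y
    by (simp add: poly_op_mult F_def self_adjoint_rinner[OF self_adjoint_poly_op[OF A]])
  have F0: "F 0 x = A x" for x
    by (simp add: F_def poly_op_X)
  have F_contr: "norm (F n x) \<le> norm x" for n x
  proof -
    have "0 \<le> rinner (poly_op A (1 - sgn_iter n * sgn_iter n) x) x"
      by (rule pos[OF sgn_iter_contr])
    then have "(norm (F n x))\<^sup>2 \<le> (norm x)\<^sup>2"
      by (simp add: poly_op_diff poly_op_1 rinner.diff_left sq rinner_self)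
    then show ?thesis by (rule power2_le_imp_le) simp
  qed
  have F_mono: "(norm (F m x))\<^sup>2 \<le> rinner (F n x) (F m x)" if "m \<le> n" for m n x
  proof -
    from that obtain v where v: "v \<in> pos_cone" "sgn_iter n = sgn_iter m + sgn_iter m * v"
      by (rule sgn_iter_factor)
    have "sgn_iter m * sgn_iter n = sgn_iter m * sgn_iter m + (sgn_iter m * sgn_iter m) * v"
      by (simp add: v(2) algebra_simps)
    moreover have "0 \<le> rinner (poly_op A ((sgn_iter m * sgn_iter m) * v) x) x"
      by (intro pos pos_cone_intros v)
    ultimately have "rinner (poly_op A (sgn_iter m * sgn_iter m) x) x \<le> rinner (poly_op A (sgn_iter m * sgn_iter n) x) x"
      by (simp add: poly_op_add rinner.add_left)
    then show ?thesis by (simp add: sq rinner_self)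
  qed
  have F_diff: "(norm (F n x - F m x))\<^sup>2 \<le> (norm (F n x))\<^sup>2 - (norm (F m x))\<^sup>2" if "m \<le> n" for m n x
    using F_mono[OF that, of x] by (simp add: power2_norm_diff)
  have "convergent (\<lambda>n. F n x)" for x
    by (rule convergent_if_norm_diff_le[OF F_diff, where B="(norm x)\<^sup>2"])
       (simp_all add: power_mono F_contr)
  then obtain J where J: "\<And>x. (\<lambda>n. F n x) \<longlonglongrightarrow> J x"
    unfolding convergent_def by metis
  have saJ: "self_adjoint J"
    by (rule self_adjoint_strong_limit[OF sa F_contr J])
  note app = tendsto_contractions_apply[OF self_adjoint_bounded_linear[OF sa] F_contr J]
  show ?thesis
  proof (rule that[OF saJ])
    fix x
    have step: "F (Suc n) x = F n x + (1/2) *\<^sub>R (F n x - F n (F n (F n x)))" for n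
      by (simp add: F_def poly_op_simps self_adjoint_diff[OF self_adjoint_poly_op[OF A]])
    have "(\<lambda>n. F (Suc n) x) \<longlonglongrightarrow> J x + (1/2) *\<^sub>R (J x - J (J (J x)))"
      unfolding step by (intro tendsto_intros J app)
    with LIMSEQ_Suc[OF J[of x]] have "J x = J x + (1/2) *\<^sub>R (J x - J (J (J x)))"
      by (rule LIMSEQ_unique)
    then show "J (J (J x)) = J x" by simp
    have "(\<lambda>n. rinner (F n x) (A x)) \<longlonglongrightarrow> rinner (J x) (A x)"
      by (intro rinner.tendsto J tendsto_const)
    moreover have "(norm (A x))\<^sup>2 \<le> rinner (F n x) (A x)" for n
      using F_mono[of 0 n x] by (simp add: F0)
    ultimately have "(norm (A x))\<^sup>2 \<le> rinner (J x) (A x)"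
      by (intro LIMSEQ_le_const) auto
    then show *: "(norm (A x))\<^sup>2 \<le> rinner (A (J x)) x"
      by (simp add: self_adjoint_rinner[OF A])
    show "A x = 0 \<longleftrightarrow> J x = 0"
    proof
      assume "A x = 0"
      moreover have "F n x = poly_op A (1 + v) (A x)" if "sgn_iter n = sgn_iter 0 + sgn_iter 0 * v" for n v
      proof -
        have "sgn_iter n = (1 + v) * [:0, 1:]"
          unfolding that by (simp add: algebra_simps)
        then show ?thesis
          by (simp only: F_def poly_op_mult[OF lin] poly_op_X[OF lin])
      qed
      ultimately have "F n x = 0" for n
        using sgn_iter_factor[of 0 n] self_adjoint_zero[OF self_adjoint_poly_op[OF A]] by (metis zero_le)
      with J[of x] show "J x = 0"
        by (simp add: LIMSEQ_const_iff)
    next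
      assume "J x = 0"
      with * show "A x = 0"
        by (simp add: self_adjoint_zero[OF A] rinner.zero_left)
    qed
  next
    have "Z (J x) = J (Z x)" if Z: "bounded_linear Z" "\<forall>x. Z (A x) = A (Z x)" for Z x
    proof -
      have "(\<lambda>n. Z (F n x)) \<longlonglongrightarrow> Z (J x)"
        by (rule bounded_linear.tendsto[OF Z(1) J])
      moreover have "Z (F n x) = F n (Z x)" for n
        unfolding F_def by (rule poly_op_commute[OF lin bounded_linear.linear[OF Z(1)] Z(2)[rule_format]])
      ultimately show ?thesis
        using J[of "Z x"] by (simp add: LIMSEQ_unique)
    qed
    then show "\<forall>Z. bounded_linear Z \<longrightarrow> (\<forall>x. Z (A x) = A (Z x)) \<longrightarrow> (\<forall>x. Z (J x) = J (Z x))"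
      by blast
  qed
qed

text \<open>A characterization of \<open>E(-\<infinity>,\<lambda>)\<close> that does not refer to a spectral measure.\<close>

definition spec_cut :: "('a::complex_hilbert_space \<Rightarrow> 'a) \<Rightarrow> real \<Rightarrow> ('a \<Rightarrow> 'a) \<Rightarrow> bool" where
  "spec_cut X lam P \<longleftrightarrow> orthogonal_projection P \<and> (\<forall>x. X (P x) = P (X x)) \<and>
     (\<forall>x. P x = x \<longrightarrow> x \<noteq> 0 \<longrightarrow> rinner (X x) x < lam * (norm x)\<^sup>2) \<and>
     (\<forall>x. P x = 0 \<longrightarrow> lam * (norm x)\<^sup>2 \<le> rinner (X x) x)"

text \<open>\<open>J\<close> is the sign of \<open>X - lam\<close>, scaled by \<open>K\<close> to a
  contraction. As \<open>J^3 = J\<close>, the operator \<open>(J^2 - J) / 2\<close> projects onto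
  the eigenspace of \<open>J\<close> for -1. The kernel of \<open>X - lam\<close> falls into the
  complement, whence the strict inequality on the range. The commutant clause serves uniqueness and
  makes cuts at different points commute.\<close>

lemma spec_cut_exists_commutant:
  fixes X :: "'a::complex_hilbert_space \<Rightarrow> 'a"
  assumes X: "self_adjoint X"
  obtains P where "spec_cut X lam P"
    "\<forall>Z. bounded_linear Z \<longrightarrow> (\<forall>x. Z (X x) = X (Z x)) \<longrightarrow> (\<forall>x. Z (P x) = P (Z x))"
proof -
  obtain K where K: "K > 0" "\<And>x. norm (X x - lam *\<^sub>R x) \<le> K * norm x"
    by (rule self_adjoint_bound[OF self_adjoint_shift[OF X, of lam]]) blast
  define A where "A x = (1 / K) *\<^sub>R (X x - lam *\<^sub>R x)" for x
  have saA: "self_adjoint A"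
    using self_adjoint_comb[OF X self_adjoint_id, of "1/K" "- lam / K"]
    by (simp add: A_def[abs_def] algebra_simps)
  have contr: "norm (A x) \<le> norm x" for x
    using K(2)[of x] K(1) unfolding A_def norm_scaleR by (simp add: field_simps)
  have rX: "rinner (A x) x = (rinner (X x) x - lam * (norm x)\<^sup>2) / K" for x
    by (simp add: A_def rinner_simps rinner_self divide_simps)
  obtain J where J: "self_adjoint J" "\<And>x. J (J (J x)) = J x" "\<And>x. (norm (A x))\<^sup>2 \<le> rinner (A (J x)) x"
    "\<And>x. A x = 0 \<longleftrightarrow> J x = 0"
    "\<forall>Z. bounded_linear Z \<longrightarrow> (\<forall>x. Z (A x) = A (Z x)) \<longrightarrow> (\<forall>x. Z (J x) = J (Z x))"
    by (rule sign_operator[OF saA contr]) (rule that)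
  note saJ = self_adjointD[OF J(1)]
  define P where "P x = (1/2) *\<^sub>R J (J x) + (-1/2) *\<^sub>R J x" for x
  have saP: "self_adjoint P"
    unfolding P_def by (rule self_adjoint_comb[OF self_adjoint_compose[OF J(1) J(1) refl] J(1)])
  have JP: "J (P x) = - P x" for x
    by (simp add: P_def saJ J(2))
  have JJP: "J (- P x) = P x" for x
    using self_adjoint_scaleR[OF J(1), of "-1" "P x"] by (simp add: JP)
  have PP: "P (P x) = P x" for x
    unfolding P_def[of "P x"] JP JJP by (simp flip: scaleR_left_distrib)
  have comm: "Z (P x) = P (Z x)" if Z: "bounded_linear Z" "\<And>x. Z (X x) = X (Z x)" for Z x
  proof -
    interpret Z: bounded_linear Z by fact
    have "Z (A x) = A (Z x)" for x
      by (simp add: A_def Z(2) Z.scaleR Z.diff)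
    with J(5) Z(1) have "Z (J x) = J (Z x)" for x by blast
    then show ?thesis
      by (simp add: P_def Z.add Z.scaleR Z.diff)
  qed
  have "spec_cut X lam P"
    unfolding spec_cut_def
  proof (intro conjI allI impI)
    show "orthogonal_projection P"
      using saP PP by (simp add: orthogonal_projection_iff)
    fix x
    show "X (P x) = P (X x)"
      using comm[OF self_adjoint_bounded_linear[OF X]] by blast
    show "rinner (X x) x < lam * (norm x)\<^sup>2" if "P x = x" "x \<noteq> 0"
    proof -
      have "J x = - x" using JP[of x] that by simp
      then have "A x \<noteq> 0" "(norm (A x))\<^sup>2 \<le> - rinner (A x) x"
        using J(3)[of x] J(4)[of x] that(2) self_adjoint_scaleR[OF saA, of "-1" x]
        by (auto simp: rinner_simps)
      then have "rinner (A x) x < 0"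
        using zero_less_power2[of "norm (A x)"] unfolding norm_eq_zero by linarith
      then show ?thesis using K(1) by (simp add: rX divide_less_0_iff)
    qed
    show "lam * (norm x)\<^sup>2 \<le> rinner (X x) x" if "P x = 0"
    proof -
      have JJ: "J (J x) = J x"
        using that unfolding P_def by (simp add: algebra_simps flip: scaleR_right_diff_distrib)
      \<comment> \<open>Where \<open>P\<close> vanishes, \<open>x - J x\<close> lies in the common
        kernel of \<open>J\<close> and \<open>A\<close>. The form of \<open>A\<close> at
        \<open>x\<close> is thus its form at \<open>J x\<close>, where \<open>J\<close> acts as the
        identity and the form bound for \<open>A J\<close> applies.\<close>
      have "A (x - J x) = 0"
        by (simp add: J(4) saJ JJ)
      then have Ax: "A x = A (J x)" by (simp add: self_adjoint_diff[OF saA])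
      have "rinner (A x) x = rinner (J x) (A x)"
        by (simp add: Ax self_adjoint_rinner[OF saA])
      also have "\<dots> = rinner (A (J (J x))) (J x)"
        by (simp add: Ax self_adjoint_rinner[OF saA] JJ)
      also have "\<dots> \<ge> 0"
        using J(3)[of "J x"] zero_le_power2 order_trans by blast
      finally show ?thesis using K(1) by (simp add: rX zero_le_divide_iff)
    qed
  qed
  then show ?thesis using comm by (intro that) blast+
qed

text \<open>Two arbitrary cuts are not known to commute, so each is compared with the cut
  \<open>G\<close> that commutes with everything commuting with \<open>X\<close>. A vector in the
  range of one and the kernel of the other satisfies contradictory form bounds unless it is
  0.\<close>

lemma spec_cut_unique:
  assumes X: "self_adjoint X" and P: "spec_cut X lam P" and R: "spec_cut X lam R"
  shows "P = R"
proof -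
  obtain G where G: "spec_cut X lam G"
    and comm: "\<forall>Z. bounded_linear Z \<longrightarrow> (\<forall>x. Z (X x) = X (Z x)) \<longrightarrow> (\<forall>x. Z (G x) = G (Z x))"
    by (rule spec_cut_exists_commutant[OF X]) (rule that)
  have "P = G" if P: "spec_cut X lam P" for P
  proof
    have oP: "orthogonal_projection P" and oG: "orthogonal_projection G"
      using P G by (auto simp: spec_cut_def)
    note saP = self_adjointD[OF oproj_self_adjoint[OF oP]] and saG = self_adjointD[OF oproj_self_adjoint[OF oG]]
    have PG: "P (G x) = G (P x)" for x
      by (rule comm[rule_format, OF saP(1)]) (use P in \<open>simp add: spec_cut_def\<close>)
    have False if "P x = x" "G x = 0" "x \<noteq> 0" for x
      using P G that unfolding spec_cut_def by fastforce
    moreover have False if "P x = 0" "G x = x" "x \<noteq> 0" for x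
      using P G that unfolding spec_cut_def by fastforce
    moreover fix x
    have "P (P x - G (P x)) = P x - G (P x)" "G (P x - G (P x)) = 0"
      "G (G x - P (G x)) = G x - P (G x)" "P (G x - P (G x)) = 0"
      by (simp_all add: saP saG PG oproj_idem[OF oP] oproj_idem[OF oG])
    ultimately have "P x - G (P x) = 0" "G x - P (G x) = 0"
      by blast+
    then show "P x = G x" by (simp add: PG)
  qed
  with P R show ?thesis by metis
qed

section \<open>Projection-valued measures\<close>

context
  fixes E :: "real set \<Rightarrow> 'a::complex_hilbert_space \<Rightarrow> 'a"
  assumes pvm: "projection_valued_measure E"
begin

lemma pvm_oproj: "A \<in> sets borel \<Longrightarrow> orthogonal_projection (E A)"
  using pvm by (simp add: projection_valued_measure_def)

lemma pvm_UNIV: "E UNIV x = x"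
  using pvm by (simp add: projection_valued_measure_def)

lemma pvm_sums:
  "range F \<subseteq> sets borel \<Longrightarrow> disjoint_family F \<Longrightarrow> (\<lambda>n. E (F n) x) sums E (\<Union>n. F n) x"
  using pvm by (simp add: projection_valued_measure_def)

lemma pvm_empty: "E {} x = 0"
proof -
  have "(\<lambda>n::nat. E {} x) sums E (\<Union>n::nat. {}) x"
    by (rule pvm_sums) (auto simp: disjoint_family_on_def)
  then have "(\<lambda>n::nat. E {} x) \<longlonglongrightarrow> 0"
    by (metis sums_summable summable_LIMSEQ_zero)
  then show ?thesis by (simp add: LIMSEQ_const_iff)
qed

lemma pvm_Un_disjoint:
  assumes "A \<in> sets borel" "B \<in> sets borel" "A \<inter> B = {}"
  shows "E (A \<union> B) x = E A x + E B x"
proof -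
  have "(\<lambda>n. E (binaryset A B n) x) sums E (\<Union>n. binaryset A B n) x"
    using assms by (intro pvm_sums) (auto simp: range_binaryset_eq disjoint_family_on_def binaryset_def)
  moreover have "(\<lambda>n. E (binaryset A B n) x) sums (E A x + E B x)"
    by (rule binaryset_sums) (rule pvm_empty)
  ultimately show ?thesis
    by (simp add: UN_binaryset_eq sums_unique2)
qed

lemma pvm_compl: "A \<in> sets borel \<Longrightarrow> E (- A) x = x - E A x"
  using pvm_Un_disjoint[of A "- A" x] by (simp add: pvm_UNIV Compl_partition algebra_simps)

text \<open>Multiplicativity has to be derived from additivity. On the range of \<open>E A\<close>,
  the contraction \<open>E (A \<union> B)\<close> has squared norm equal to that of the vector plus
  that of its \<open>E B\<close> part, so this part vanishes.\<close>

lemma pvm_disjoint: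
  assumes "A \<in> sets borel" "B \<in> sets borel" "A \<inter> B = {}"
  shows "E B (E A x) = 0"
proof -
  have "E (A \<union> B) (E A x) = E A x + E B (E A x)"
    by (simp add: pvm_Un_disjoint[OF assms] oproj_idem[OF pvm_oproj[OF assms(1)]])
  then have "(norm (E A x))\<^sup>2 + (norm (E B (E A x)))\<^sup>2 = (norm (E (A \<union> B) (E A x)))\<^sup>2"
    using oproj_rinner[OF pvm_oproj, of "A \<union> B" "E A x"] oproj_rinner[OF pvm_oproj, of "B" "E A x"] assms
    by (simp add: rinner.add_left rinner_self)
  also have "\<dots> \<le> (norm (E A x))\<^sup>2"
    using assms by (intro power_mono oproj_norm_le pvm_oproj) auto
  finally show ?thesis by simp
qed

lemma pvm_mult:
  assumes "A \<in> sets borel" "B \<in> sets borel"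
  shows "E A (E B x) = E (A \<inter> B) x"
proof -
  note sa = self_adjointD[OF oproj_self_adjoint[OF pvm_oproj]]
  have "E B x = E (A \<inter> B) x + E (B - A) x"
    using pvm_Un_disjoint[of "A \<inter> B" "B - A" x] assms
    by (simp add: Int_Diff_Un Int_commute) (metis Diff_disjoint Int_Diff Int_Diff_Un Int_commute)
  then have "E A (E B x) = E A (E (A \<inter> B) x)"
    using assms pvm_disjoint[of "B - A" A x] by (simp add: sa Int_commute)
  also have "\<dots> = E ((A \<inter> B) \<union> (A - B)) (E (A \<inter> B) x)"
    by (simp add: Int_Diff_Un)
  also have "\<dots> = E (A \<inter> B) (E (A \<inter> B) x) + E (A - B) (E (A \<inter> B) x)"
    using assms by (intro pvm_Un_disjoint) auto
  also have "\<dots> = E (A \<inter> B) x"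
    using assms by (subst pvm_disjoint[of "A \<inter> B" "A - B"]) (auto simp: oproj_idem[OF pvm_oproj])
  finally show ?thesis .
qed

lemma sets_scalar_measure [simp, measurable_cong]: "sets (scalar_measure E x) = sets borel"
  using sets.sigma_sets_eq[of "borel :: real measure"] by (simp add: scalar_measure_def)

lemma space_scalar_measure [simp]: "space (scalar_measure E x) = UNIV"
  by (simp add: scalar_measure_def)

lemma emeasure_scalar_measure:
  assumes "A \<in> sets borel"
  shows "emeasure (scalar_measure E x) A = ennreal ((norm (E A x))\<^sup>2)"
proof -
  define \<mu> where "\<mu> \<Omega> = ennreal (rinner (E \<Omega> x) x)" for \<Omega>
  have "emeasure (scalar_measure E x) A = \<mu> A"
  proof (rule emeasure_measure_of)
    show "scalar_measure E x = measure_of UNIV (sets borel) \<mu>"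
      by (simp add: scalar_measure_def \<mu>_def[abs_def] rinner_def)
    show "positive (sets (scalar_measure E x)) \<mu>"
      by (simp add: positive_def \<mu>_def pvm_empty rinner.zero_left)
    show "countably_additive (sets (scalar_measure E x)) \<mu>"
    proof (rule countably_additiveI)
      fix F :: "nat \<Rightarrow> real set"
      assume F: "range F \<subseteq> sets (scalar_measure E x)" "disjoint_family F"
      have "(\<lambda>n. rinner (E (F n) x) x) sums rinner (E (\<Union>n. F n) x) x"
        using bounded_linear.sums[OF rinner.bounded_linear_left pvm_sums] F by simp
      moreover have "0 \<le> rinner (E (F n) x) x" for n
        using F by (subst oproj_rinner[OF pvm_oproj]) auto
      ultimately show "(\<Sum>n. \<mu> (F n)) = \<mu> (\<Union>n. F n)"
        unfolding \<mu>_def by (intro suminf_ennreal_eq)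
    qed
  qed (use assms in auto)
  then show ?thesis by (simp add: \<mu>_def oproj_rinner[OF pvm_oproj[OF assms]])
qed

lemma finite_measure_scalar_measure: "finite_measure (scalar_measure E x)"
  by (rule finite_measureI) (simp add: emeasure_scalar_measure)

lemma measure_scalar_measure_UNIV: "measure (scalar_measure E x) UNIV = (norm x)\<^sup>2"
  by (simp add: measure_def emeasure_scalar_measure pvm_UNIV)

lemma AE_scalar_measure:
  assumes "A \<in> sets borel" "E A x = x"
  shows "AE t in scalar_measure E x. t \<in> A"
proof (rule AE_I)
  show "emeasure (scalar_measure E x) (- A) = 0"
    using assms by (simp add: emeasure_scalar_measure pvm_compl)
qed (use assms in auto)

lemma scalar_measure_restrict:
  assumes "A \<in> sets borel"
  shows "scalar_measure E (E A x) = density (scalar_measure E x) (\<lambda>t. ennreal (indicator A t))"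
proof (rule measure_eqI)
  fix B assume "B \<in> sets (scalar_measure E (E A x))"
  then have B: "B \<in> sets borel" by simp
  have "emeasure (density (scalar_measure E x) (\<lambda>t. ennreal (indicator A t))) B
      = (\<integral>\<^sup>+t. ennreal (indicator A t) * indicator B t \<partial>scalar_measure E x)"
    using assms B by (intro emeasure_density) auto
  also have "\<dots> = (\<integral>\<^sup>+t. indicator (B \<inter> A) t \<partial>scalar_measure E x)"
    by (intro nn_integral_cong) (auto split: split_indicator)
  also have "\<dots> = emeasure (scalar_measure E (E A x)) B"
    using assms B by (simp add: emeasure_scalar_measure pvm_mult)
  finally show "emeasure (scalar_measure E (E A x)) B
      = emeasure (density (scalar_measure E x) (\<lambda>t. ennreal (indicator A t))) B" by simp
qed simp

text \<open>Cutting the vector by \<open>E A\<close> cuts its scalar measure by the indicator of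
  \<open>A\<close>, so the form has no cross terms between the range of \<open>E A\<close> and its
  complement.\<close>

lemma integral_scalar_measure_split:
  assumes A: "A \<in> sets borel" and int: "integrable (scalar_measure E x) (\<lambda>t. t)"
  shows "(\<integral>t. t \<partial>scalar_measure E x)
    = (\<integral>t. t \<partial>scalar_measure E (E A x)) + (\<integral>t. t \<partial>scalar_measure E (x - E A x))"
proof -
  have *: "(\<integral>t. t \<partial>scalar_measure E (E B x)) = (\<integral>t. indicator B t *\<^sub>R t \<partial>scalar_measure E x)"
    if "B \<in> sets borel" for B
    using that by (simp add: scalar_measure_restrict integral_density)
  have "(\<integral>t. t \<partial>scalar_measure E x) = (\<integral>t. indicator A t *\<^sub>R t + indicator (- A) t *\<^sub>R t \<partial>scalar_measure E x)"
    by (intro Bochner_Integration.integral_cong) (auto split: split_indicator)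
  also have "\<dots> = (\<integral>t. indicator A t *\<^sub>R t \<partial>scalar_measure E x) + (\<integral>t. indicator (- A) t *\<^sub>R t \<partial>scalar_measure E x)"
    using A int by (intro Bochner_Integration.integral_add integrable_mult_indicator) auto
  finally show ?thesis
    using A by (simp add: * flip: pvm_compl)
qed

lemma
  assumes A: "A \<in> sets borel" "E A x = x" and int: "integrable (scalar_measure E x) (\<lambda>t. t)"
  shows integral_scalar_measure_le: "A \<subseteq> {..b} \<Longrightarrow> (\<integral>t. t \<partial>scalar_measure E x) \<le> b * (norm x)\<^sup>2"
    and integral_scalar_measure_ge: "A \<subseteq> {b..} \<Longrightarrow> b * (norm x)\<^sup>2 \<le> (\<integral>t. t \<partial>scalar_measure E x)"
    and integral_scalar_measure_less:
      "A \<subseteq> {..<b} \<Longrightarrow> x \<noteq> 0 \<Longrightarrow> (\<integral>t. t \<partial>scalar_measure E x) < b * (norm x)\<^sup>2"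
proof -
  interpret finite_measure "scalar_measure E x" by (rule finite_measure_scalar_measure)
  note AE = AE_scalar_measure[OF A]
  have const: "(\<integral>t. b \<partial>scalar_measure E x) = b * (norm x)\<^sup>2"
    by (simp add: measure_scalar_measure_UNIV)
  show le: "(\<integral>t. t \<partial>scalar_measure E x) \<le> b * (norm x)\<^sup>2" if "A \<subseteq> {..b}"
    unfolding const[symmetric] by (rule integral_mono_AE) (use int AE that in auto)
  show "b * (norm x)\<^sup>2 \<le> (\<integral>t. t \<partial>scalar_measure E x)" if "A \<subseteq> {b..}"
    unfolding const[symmetric] by (rule integral_mono_AE) (use int AE that in auto)
  show "(\<integral>t. t \<partial>scalar_measure E x) < b * (norm x)\<^sup>2" if "A \<subseteq> {..<b}" "x \<noteq> 0"
  proof (rule ccontr)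
    assume "\<not> ?thesis"
    with le that have eq: "(\<integral>t. t \<partial>scalar_measure E x) = b * (norm x)\<^sup>2" by force
    have "(\<integral>t. b - t \<partial>scalar_measure E x) = 0"
      using int by (simp add: eq measure_scalar_measure_UNIV)
    moreover have "AE t in scalar_measure E x. 0 \<le> b - t"
      using AE by eventually_elim (use that in auto)
    ultimately have "AE t in scalar_measure E x. b - t = 0"
      using int by (subst (asm) integral_nonneg_eq_0_iff_AE) auto
    with AE have "AE t in scalar_measure E x. False"
      by eventually_elim (use that in auto)
    then have "emeasure (scalar_measure E x) UNIV = 0"
      by (subst (asm) AE_iff_measurable[of UNIV]) auto
    with that(2) show False by (simp add: emeasure_scalar_measure pvm_UNIV)
  qed
qed

context
  fixes X :: "'a \<Rightarrow> 'a"
  assumes X: "self_adjoint X" and sm: "spectral_measure_of X E"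
begin

lemma spectral_measure_form: "rinner (X x) x = (\<integral>t. t \<partial>scalar_measure E x)"
  and spectral_measure_integrable: "integrable (scalar_measure E x) (\<lambda>t. t)"
  using sm by (simp_all add: spectral_measure_of_def rinner_def)

text \<open>Let \<open>w\<close> be the part of \<open>X (E A x)\<close> outside the range of
  \<open>E A\<close>. The cross term of the form at \<open>E A x + w\<close> is twice
  \<open>(norm w)\<^sup>2\<close>, and it vanishes because the form splits. Hence the range of
  \<open>E A\<close> is invariant under \<open>X\<close>.\<close>

lemma spectral_measure_commute:
  assumes A: "A \<in> sets borel"
  shows "X (E A x) = E A (X x)"
proof (rule oproj_commuteI[OF pvm_oproj[OF A] X])
  fix x
  note P = pvm_oproj[OF A]
  note saP = self_adjointD[OF oproj_self_adjoint[OF P]]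
  define w where "w = X (E A x) - E A (X (E A x))"
  define z where "z = E A x + w"
  have z: "E A z = E A x" "z - E A z = w"
    by (simp_all add: z_def w_def saP oproj_idem[OF P])
  have "rinner (X z) z = rinner (X (E A z)) (E A z) + rinner (X (z - E A z)) (z - E A z)"
    unfolding spectral_measure_form by (rule integral_scalar_measure_split[OF A spectral_measure_integrable])
  then have "rinner (X (E A x)) w + rinner (X w) (E A x) = 0"
    unfolding z unfolding z_def by (simp add: self_adjoint_add[OF X] rinner_simps)
  moreover have "rinner (X w) (E A x) = rinner (X (E A x)) w"
    using self_adjoint_rinner[OF X, of w "E A x"] rinner_commute by metis
  ultimately have "rinner (X (E A x)) w = 0" by simp
  moreover have "rinner (E A (X (E A x))) w = 0"
    unfolding w_def by (rule oproj_orth[OF P])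
  moreover have "rinner w w = rinner (X (E A x)) w - rinner (E A (X (E A x))) w"
    by (metis w_def rinner.diff_left)
  ultimately have "rinner w w = 0" by simp
  then show "E A (X (E A x)) = X (E A x)"
    by (simp add: rinner_self w_def)
qed

lemma spectral_measure_le:
  "A \<in> sets borel \<Longrightarrow> A \<subseteq> {..b} \<Longrightarrow> E A x = x \<Longrightarrow> rinner (X x) x \<le> b * (norm x)\<^sup>2"
  by (simp add: spectral_measure_form integral_scalar_measure_le spectral_measure_integrable)

lemma spectral_measure_ge:
  "A \<in> sets borel \<Longrightarrow> A \<subseteq> {b..} \<Longrightarrow> E A x = x \<Longrightarrow> b * (norm x)\<^sup>2 \<le> rinner (X x) x"
  by (simp add: spectral_measure_form integral_scalar_measure_ge spectral_measure_integrable)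

text \<open>The link from an arbitrary spectral measure to the intrinsic description. The half-line
  is open, hence the strict inequality on the range.\<close>

lemma spectral_measure_cut: "spec_cut X b (E {..<b})"
  unfolding spec_cut_def
proof (intro conjI allI impI)
  fix x
  show "rinner (X x) x < b * (norm x)\<^sup>2" if "E {..<b} x = x" "x \<noteq> 0"
    unfolding spectral_measure_form
    by (rule integral_scalar_measure_less[OF _ that(1) spectral_measure_integrable]) (use that in auto)
  show "b * (norm x)\<^sup>2 \<le> rinner (X x) x" if "E {..<b} x = 0"
    using spectral_measure_ge[of "- {..<b}" b x] that pvm_compl[of "{..<b}" x] by force
qed (auto simp: pvm_oproj spectral_measure_commute)

end

end

section \<open>Existence and uniqueness of spectral projections\<close>

text \<open>\<open>G t\<close> plays the part of the projection for the closed half-line up to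
  \<open>t\<close>, so the strict inequality sits on the kernel. Closed half-lines give the
  right-continuous distribution functions from which \<open>interval_measure\<close> builds a
  measure.\<close>

locale spectral_family =
  fixes X :: "'a::complex_hilbert_space \<Rightarrow> 'a" and G :: "real \<Rightarrow> 'a \<Rightarrow> 'a"
  assumes X: "self_adjoint X"
    and G: "orthogonal_projection (G t)"
    and X_G: "X (G t x) = G t (X x)"
    and G_commute: "G s (G t x) = G t (G s x)"
    and form_le: "G t x = x \<Longrightarrow> rinner (X x) x \<le> t * (norm x)\<^sup>2"
    and form_gt: "G t x = 0 \<Longrightarrow> x \<noteq> 0 \<Longrightarrow> t * (norm x)\<^sup>2 < rinner (X x) x"

text \<open>Reflection turns open half-lines into closed ones: the projection of \<open>X\<close> up
  to and including \<open>t\<close> is the complement of the cut of \<open>- X\<close> at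
  \<open>- t\<close>.\<close>

lemma spectral_family_exists:
  assumes X: "self_adjoint X"
  obtains G where "spectral_family X G"
proof -
  let ?Y = "\<lambda>x. - X x"
  have Y: "self_adjoint ?Y" by (rule self_adjoint_uminus[OF X])
  have "\<exists>P. spec_cut ?Y t P \<and>
      (\<forall>Z. bounded_linear Z \<longrightarrow> (\<forall>x. Z (?Y x) = ?Y (Z x)) \<longrightarrow> (\<forall>x. Z (P x) = P (Z x)))" for t
    by (rule spec_cut_exists_commutant[OF Y]) blast
  then obtain P where P: "\<And>t. spec_cut ?Y t (P t)"
    and comm: "\<And>t. \<forall>Z. bounded_linear Z \<longrightarrow> (\<forall>x. Z (?Y x) = ?Y (Z x)) \<longrightarrow> (\<forall>x. Z (P t x) = P t (Z x))"
    by metis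
  have oP: "orthogonal_projection (P t)" and YP: "?Y (P t x) = P t (?Y x)"
    and less: "P t x = x \<Longrightarrow> x \<noteq> 0 \<Longrightarrow> rinner (?Y x) x < t * (norm x)\<^sup>2"
    and le: "P t x = 0 \<Longrightarrow> t * (norm x)\<^sup>2 \<le> rinner (?Y x) x" for t x
    using P[of t] unfolding spec_cut_def by blast+
  note saP = self_adjointD[OF oproj_self_adjoint[OF oP]]
  have PP: "P s (P t x) = P t (P s x)" for s t x
    by (rule comm[rule_format, OF saP(1)]) (rule YP[symmetric])
  have "spectral_family X (\<lambda>t x. x - P (- t) x)"
  proof
    fix s t x
    show "orthogonal_projection (\<lambda>x. x - P (- t) x)" by (rule oproj_compl[OF oP])
    show "X (x - P (- t) x) = X x - P (- t) (X x)"
      using YP[of "-t" x] self_adjoint_scaleR[OF oproj_self_adjoint[OF oP[of "-t"]], of "-1" "X x"]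
      by (simp add: self_adjoint_diff[OF X])
    show "x - P (- t) x - P (- s) (x - P (- t) x) = x - P (- s) x - P (- t) (x - P (- s) x)"
      by (simp add: saP PP[of "-s" "-t"])
    show "rinner (X x) x \<le> t * (norm x)\<^sup>2" if "x - P (- t) x = x"
      using le[of "-t" x] that by (simp add: rinner.minus_left)
    show "t * (norm x)\<^sup>2 < rinner (X x) x" if "x - P (- t) x = 0" "x \<noteq> 0"
      using less[of "-t" x] that by (simp add: rinner.minus_left)
  qed (rule X)
  then show ?thesis by (rule that)
qed

context spectral_family
begin

lemmas saG = self_adjointD[OF oproj_self_adjoint[OF G]]

lemma form_eq_zeroI: "rinner (X x) x \<le> t * (norm x)\<^sup>2 \<Longrightarrow> G t x = 0 \<Longrightarrow> x = 0"
  using form_gt[of t x] by force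

lemma G_mono: "s \<le> t \<Longrightarrow> G t (G s x) = G s x"
proof -
  assume "s \<le> t"
  define y where "y = G s x - G t (G s x)"
  have "G s y = y" "G t y = 0"
    by (simp_all add: y_def saG oproj_idem[OF G] G_commute[of s t])
  then have "y = 0"
    using form_le[of s y] \<open>s \<le> t\<close> form_eq_zeroI[of y t]
    by (meson mult_right_mono order_trans zero_le_power2)
  then show ?thesis by (simp add: y_def)
qed

lemma G_mono': "s \<le> t \<Longrightarrow> G s (G t x) = G s x"
  by (simp add: G_commute[of s t] G_mono)

definition F :: "'a \<Rightarrow> real \<Rightarrow> real" where
  "F x t = (norm (G t x))\<^sup>2"

lemma F_mono: "s \<le> t \<Longrightarrow> F x s \<le> F x t"
  unfolding F_def using oproj_norm_le[OF G, of s "G t x"] by (simp add: G_mono' power_mono)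

text \<open>The projections \<open>G (a + 1 / (n + 1))\<close> decrease strongly to a projection
  \<open>H\<close>. A vector \<open>H x - G a (H x)\<close> has form at most
  \<open>a * (norm y)\<^sup>2\<close> as a limit, yet is killed by \<open>G a\<close>, so it is 0
  and \<open>H = G a\<close>.\<close>

lemma F_right_continuous: "continuous (at_right a) (F x)"
proof -
  define t where "t n = a + 1 / real (Suc n)" for n
  have t: "a < t n" for n by (simp add: t_def)
  have t_mono: "m \<le> n \<Longrightarrow> t n \<le> t m" for m n
    by (simp add: t_def frac_le)
  have t_lim: "t \<longlonglongrightarrow> a"
    using tendsto_add[OF tendsto_const[of a] LIMSEQ_inverse_real_of_nat] by (simp add: t_def[abs_def] inverse_eq_divide)
  obtain H' where H': "orthogonal_projection H'" "\<And>x. (\<lambda>n. x - G (t n) x) \<longlonglongrightarrow> H' x"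
  proof (rule oproj_incseq_strong_limit[of "\<lambda>n x. x - G (t n) x"])
    show "orthogonal_projection (\<lambda>x. x - G (t n) x)" for n
      by (rule oproj_compl[OF G])
    show "x - G (t m) x - G (t n) (x - G (t m) x) = x - G (t m) x" if "m \<le> n" for m n x
      using G_mono'[OF t_mono[OF that]] by (simp add: saG)
  qed (rule that)
  define H where "H x = x - H' x" for x
  have oH: "orthogonal_projection H"
    unfolding H_def by (rule oproj_compl[OF H'(1)])
  have H: "(\<lambda>n. G (t n) x) \<longlonglongrightarrow> H x" for x
    using tendsto_diff[OF tendsto_const[of x] H'(2)[of x]] by (simp add: H_def)
  have GH: "G a (H x) = G a x" for x
  proof -
    have "(\<lambda>n. G a (G (t n) x)) \<longlonglongrightarrow> G a (H x)"
      by (rule bounded_linear.tendsto[OF saG(1) H])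
    then show ?thesis
      using t by (simp add: G_mono' less_imp_le LIMSEQ_const_iff)
  qed
  have tH: "G (t n) (H x) = H x" for n x
  proof -
    have "(\<lambda>m. G (t n) (G (t m) x)) \<longlonglongrightarrow> G (t n) (H x)"
      by (rule bounded_linear.tendsto[OF saG(1) H])
    moreover have "\<forall>\<^sub>F m in sequentially. G (t n) (G (t m) x) = G (t m) x"
      using eventually_ge_at_top[of n] by eventually_elim (simp add: G_mono t_mono)
    ultimately have "(\<lambda>m. G (t m) x) \<longlonglongrightarrow> G (t n) (H x)"
      by (simp add: tendsto_cong)
    then show ?thesis using H[of x] by (rule LIMSEQ_unique)
  qed
  have HG: "H x = G a x" for x
  proof -
    define y where "y = H x - G a (H x)"
    have "G (t n) y = y" for n
      using G_mono[OF less_imp_le[OF t[of n]]] by (simp add: y_def saG tH)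
    then have le: "rinner (X y) y \<le> t n * (norm y)\<^sup>2" for n
      by (rule form_le)
    have "rinner (X y) y \<le> a * (norm y)\<^sup>2"
      by (rule LIMSEQ_le_const[OF tendsto_mult[OF t_lim tendsto_const]]) (use le in auto)
    moreover have "G a y = 0" by (simp add: y_def saG oproj_idem[OF G])
    ultimately have "y = 0" by (rule form_eq_zeroI)
    then show ?thesis by (simp add: y_def GH)
  qed
  have lim: "(\<lambda>n. F x (t n)) \<longlonglongrightarrow> F x a"
    unfolding F_def HG[symmetric] by (intro tendsto_intros H)
  have "\<exists>d>0. F x (a + d) - F x a < e" if "e > 0" for e
  proof -
    from lim that have "\<forall>\<^sub>F n in sequentially. dist (F x (t n)) (F x a) < e"
      by (rule tendstoD)
    then obtain n where "dist (F x (t n)) (F x a) < e"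
      by (auto simp: eventually_sequentially)
    then show ?thesis
      by (intro exI[of _ "1 / real (Suc n)"]) (auto simp: t_def dist_real_def)
  qed
  then show ?thesis
    by (subst continuous_at_right_real_increasing) (auto intro: F_mono)
qed

text \<open>\<open>K\<close> is a norm bound of \<open>X\<close>. The endpoint \<open>- K\<close>
  must stay out on the left because it may be an eigenvalue, and \<open>G\<close> includes its
  endpoint.\<close>

lemma G_outside:
  obtains K where "K > 0" "\<And>t x. t < - K \<Longrightarrow> G t x = 0" "\<And>t x. K \<le> t \<Longrightarrow> G t x = x"
proof -
  obtain K where K: "K > 0" "\<And>x. norm (X x) \<le> K * norm x"
    by (rule self_adjoint_bound[OF X]) blast
  have bd: "\<bar>rinner (X x) x\<bar> \<le> K * (norm x)\<^sup>2" for x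
    using abs_rinner_le_norm[of "X x" x] mult_right_mono[OF K(2)[of x], of "norm x"]
    by (simp add: power2_eq_square mult.assoc)
  show ?thesis
  proof (rule that[OF K(1)])
    fix t x
    show "G t x = 0" if "t < - K"
    proof (rule ccontr)
      assume "G t x \<noteq> 0"
      then have "t * (norm (G t x))\<^sup>2 < - K * (norm (G t x))\<^sup>2"
        using that by (intro mult_strict_right_mono) auto
      then show False
        using form_le[of t "G t x"] bd[of "G t x"] by (simp add: oproj_idem[OF G])
    qed
    show "G t x = x" if "K \<le> t"
    proof -
      have "G t (x - G t x) = 0" by (simp add: saG oproj_idem[OF G])
      moreover have "rinner (X (x - G t x)) (x - G t x) \<le> t * (norm (x - G t x))\<^sup>2"
        using bd[of "x - G t x"] mult_right_mono[OF that, of "(norm (x - G t x))\<^sup>2"] by simp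
      ultimately have "x - G t x = 0" using form_eq_zeroI by blast
      then show ?thesis by simp
    qed
  qed
qed

definition \<mu> :: "'a \<Rightarrow> real measure" where
  "\<mu> x = interval_measure (F x)"

lemma F_at_bot: "(F x \<longlongrightarrow> 0) at_bot"
proof -
  obtain K where K: "\<And>t x. t < - K \<Longrightarrow> G t x = 0" by (rule G_outside) blast
  show ?thesis
    by (rule tendsto_eventually) (use eventually_gt_at_bot[of "-K"] in \<open>auto simp: F_def K eventually_at_bot_dense intro!: exI[of _ "-K"]\<close>)
qed

lemma F_at_top: "(F x \<longlongrightarrow> (norm x)\<^sup>2) at_top"
proof -
  obtain K where K: "\<And>t x. K \<le> t \<Longrightarrow> G t x = x" by (rule G_outside) blast
  show ?thesis
    by (rule tendsto_eventually) (auto simp: F_def K eventually_at_top_linorder intro!: exI[of _ "K"])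
qed

lemma sets_\<mu> [simp]: "sets (\<mu> x) = sets borel" and space_\<mu> [simp]: "space (\<mu> x) = UNIV"
  by (simp_all add: \<mu>_def)

lemma emeasure_\<mu>_UNIV: "emeasure (\<mu> x) UNIV = ennreal ((norm x)\<^sup>2)"
  unfolding \<mu>_def using interval_measure_UNIV[OF F_mono F_right_continuous F_at_bot F_at_top] by simp

lemma finite_measure_\<mu>: "finite_measure (\<mu> x)"
  by (rule finite_measureI) (simp add: emeasure_\<mu>_UNIV)

lemma measure_\<mu>_UNIV: "measure (\<mu> x) UNIV = (norm x)\<^sup>2"
  by (simp add: measure_def emeasure_\<mu>_UNIV)

lemma measure_\<mu>_atMost: "measure (\<mu> x) {..t} = (norm (G t x))\<^sup>2"
  unfolding \<mu>_def using measure_interval_measure_Iic[OF F_mono F_right_continuous F_at_bot]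
  by (simp add: F_def)

text \<open>One projection has to give the mass of \<open>A\<close> for all vectors at once. It is
  then determined by its quadratic form, so projections can be found set by set.\<close>

definition represents :: "('a \<Rightarrow> 'a) \<Rightarrow> real set \<Rightarrow> bool" where
  "represents P A \<longleftrightarrow> orthogonal_projection P \<and> (\<forall>x. measure (\<mu> x) A = (norm (P x))\<^sup>2)"

lemma represents_unique: "represents P A \<Longrightarrow> represents R A \<Longrightarrow> P = R"
  unfolding represents_def by (intro oproj_eqI) (auto simp: oproj_rinner)

text \<open>The measure of \<open>R x\<close> has total mass \<open>(norm (R x))\<^sup>2\<close>,
  and \<open>B\<close> already carries all of it, so nothing is left for \<open>A\<close>.\<close>

lemma represents_orth:
  assumes P: "represents P A" and R: "represents R B"
    and AB: "A \<in> sets borel" "B \<in> sets borel" "A \<inter> B = {}"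
  shows "P (R x) = 0"
proof -
  interpret finite_measure "\<mu> (R x)" by (rule finite_measure_\<mu>)
  have oP: "orthogonal_projection P" and oR: "orthogonal_projection R"
    using P R by (auto simp: represents_def)
  have "measure (\<mu> (R x)) A + measure (\<mu> (R x)) B = measure (\<mu> (R x)) (A \<union> B)"
    using AB by (intro finite_measure_Union[symmetric]) auto
  also have "\<dots> \<le> measure (\<mu> (R x)) UNIV"
    using bounded_measure by simp
  finally show ?thesis
    using P R by (simp add: represents_def measure_\<mu>_UNIV oproj_idem[OF oR])
qed

lemma represents_UN:
  fixes A :: "nat \<Rightarrow> real set"
  assumes P: "\<And>n. represents (P n) (A n)"
    and A: "range A \<subseteq> sets borel" "disjoint_family A"
  obtains R where "represents R (\<Union>n. A n)" "\<And>x. (\<lambda>n. P n x) sums R x"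
proof -
  have oP: "orthogonal_projection (P n)" for n
    using P by (simp add: represents_def)
  have orth: "P m (P n x) = 0" if "m \<noteq> n" for m n x
    using A that by (intro represents_orth[OF P P]) (auto simp: disjoint_family_on_def)
  obtain R where R: "orthogonal_projection R" "\<And>x. (\<lambda>n. P n x) sums R x"
    by (rule oproj_sums[of P, OF oP orth]) blast+
  have "measure (\<mu> x) (\<Union>n. A n) = (norm (R x))\<^sup>2" for x
  proof -
    interpret finite_measure "\<mu> x" by (rule finite_measure_\<mu>)
    have "(\<lambda>n. measure (\<mu> x) (A n)) sums measure (\<mu> x) (\<Union>n. A n)"
      using A by (intro finite_measure_UNION) auto
    moreover have "(\<lambda>n. rinner (P n x) x) sums rinner (R x) x"
      by (rule bounded_linear.sums[OF rinner.bounded_linear_left R(2)])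
    ultimately show ?thesis
      using P R(1) by (simp add: represents_def oproj_rinner sums_unique2)
  qed
  with R show ?thesis by (intro that[of R]) (auto simp: represents_def)
qed

text \<open>Closed half-lines are stable under intersection, so the union case need only treat
  disjoint sets, for which the projections are orthogonal and their sum is again a
  projection.\<close>

lemma represents_exists:
  assumes "A \<in> sets borel"
  shows "\<exists>P. represents P A"
proof -
  have gen: "sets borel = sigma_sets UNIV (range atMost :: real set set)"
    unfolding borel_eq_atMost by (rule sets_measure_of) simp
  have "Int_stable (range atMost :: real set set)"
    by (auto simp: Int_stable_def)
  moreover have "(range atMost :: real set set) \<subseteq> Pow UNIV" by simp
  moreover have "A \<in> sigma_sets UNIV (range atMost)"
    using assms by (simp add: gen)
  ultimately show ?thesis
  proof (induction rule: sigma_sets_induct_disjoint)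
    case (basic A)
    then obtain t where "A = {..t}" by blast
    then have "represents (G t) A"
      by (simp add: represents_def G measure_\<mu>_atMost)
    then show ?case by blast
  next
    case empty
    have "represents (\<lambda>x. 0) {}" by (simp add: represents_def oproj_zero)
    then show ?case by blast
  next
    case (compl A)
    then obtain P where P: "represents P A" by blast
    have "represents (\<lambda>x. x - P x) (UNIV - A)"
      unfolding represents_def
    proof (intro conjI allI oproj_compl)
      show oP: "orthogonal_projection P" using P by (simp add: represents_def)
      fix x
      interpret finite_measure "\<mu> x" by (rule finite_measure_\<mu>)
      show "measure (\<mu> x) (UNIV - A) = (norm (x - P x))\<^sup>2"
        using finite_measure_compl[of A] compl(1) P oproj_pythagoras[OF oP, of x]
        by (simp add: measure_\<mu>_UNIV represents_def gen)
    qed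
    then show ?case by blast
  next
    case (union A)
    then obtain P where "\<And>n. represents (P n) (A n)" by metis
    with union show ?case
      by (metis represents_UN gen)
  qed
qed

definition E :: "real set \<Rightarrow> 'a \<Rightarrow> 'a" where
  "E A = (SOME P. represents P A)"

lemma E: "A \<in> sets borel \<Longrightarrow> represents (E A) A"
  unfolding E_def by (rule someI_ex[of "\<lambda>P. represents P A"]) (rule represents_exists)

lemma E_eqI: "represents P A \<Longrightarrow> A \<in> sets borel \<Longrightarrow> E A = P"
  using E represents_unique by blast

lemma pvm_E: "projection_valued_measure E"
  unfolding projection_valued_measure_def
proof (intro conjI ballI allI impI)
  show "orthogonal_projection (E A)" if "A \<in> sets borel" for A
    using E[OF that] by (simp add: represents_def)
  show "E UNIV = id"
    by (rule E_eqI) (simp_all add: represents_def measure_\<mu>_UNIV oproj_id id_def)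
  fix A :: "nat \<Rightarrow> real set" and x
  assume "range A \<subseteq> sets borel \<and> disjoint_family A"
  then have A: "range A \<subseteq> sets borel" "disjoint_family A" by auto
  show "(\<lambda>n. E (A n) x) sums E (\<Union>n. A n) x"
  proof (rule represents_UN[OF _ A])
    show "represents (E (A n)) (A n)" for n using A(1) by (intro E) auto
    fix R assume R: "represents R (\<Union>n. A n)" "\<And>x. (\<lambda>n. E (A n) x) sums R x"
    have "E (\<Union>n. A n) = R" using A(1) by (intro E_eqI R) auto
    with R show ?thesis by simp
  qed
qed

lemma E_atMost: "E {..t} = G t"
  by (rule E_eqI) (simp_all add: represents_def G measure_\<mu>_atMost)

lemma E_Ioc: "a \<le> b \<Longrightarrow> E {a<..b} x = G b x - G a x"
  using pvm_Un_disjoint[OF pvm_E, of "{..a}" "{a<..b}" x]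
  by (simp add: ivl_disj_un E_atMost ivl_disj_int)

lemma integrable_E: "integrable (scalar_measure E x) (\<lambda>t. t)"
proof -
  interpret finite_measure "scalar_measure E x" by (rule finite_measure_scalar_measure[OF pvm_E])
  obtain K where K: "K > 0" "\<And>t x. t < - K \<Longrightarrow> G t x = 0" "\<And>t x. K \<le> t \<Longrightarrow> G t x = x"
    by (rule G_outside) blast
  \<comment> \<open>The left end is moved to \<open>- (K + 1)\<close> since \<open>G\<close> may be
    nonzero at \<open>- K\<close>.\<close>
  have "E {- (K + 1)<..K} x = x"
    using E_Ioc[of "- (K + 1)" K x] K(1) K(2)[of "- (K + 1)" x] K(3)[of K x] by simp
  then have "AE t in scalar_measure E x. t \<in> {- (K + 1) <.. K}"
    by (intro AE_scalar_measure[OF pvm_E]) auto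
  then have "AE t in scalar_measure E x. norm t \<le> K + 1"
    by eventually_elim (use K(1) in auto)
  then show ?thesis
    by (rule integrable_const_bound) (simp add: measurable_cong_sets[OF sets_scalar_measure[OF pvm_E] refl])
qed

text \<open>Bisection: halving the interval halves the bound on the defect of the form, because the
  defect is additive under the decomposition by a spectral projection.\<close>

lemma form_defect_bound:
  assumes "E {a<..b} x = x" "a \<le> b"
  shows "\<bar>rinner (X x) x - (\<integral>t. t \<partial>scalar_measure E x)\<bar> \<le> (b - a) / 2 ^ n * (norm x)\<^sup>2"
  using assms
proof (induction n arbitrary: a b x)
  \<comment> \<open>The form and the integral both lie between \<open>a\<close> and \<open>b\<close>
    times \<open>(norm x)\<^sup>2\<close>.\<close>
  case 0
  have "G b x = x"
    using 0 E_Ioc[of a b x] G_mono[of a b x] oproj_idem[OF G, of b x] saG(5)[of b] by metis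
  moreover have "G a x = 0"
    using 0 E_Ioc[of a b x] G_mono'[of a b x] oproj_idem[OF G, of a x] saG(5)[of a] by (metis diff_self)
  ultimately have "rinner (X x) x \<le> b * (norm x)\<^sup>2" "a * (norm x)\<^sup>2 \<le> rinner (X x) x"
    using form_le[of b x] form_gt[of a x] by (cases "x = 0"; force simp: rinner.zero_right)+
  moreover have "(\<integral>t. t \<partial>scalar_measure E x) \<le> b * (norm x)\<^sup>2"
    by (rule integral_scalar_measure_le[OF pvm_E _ 0(1) integrable_E]) auto
  moreover have "a * (norm x)\<^sup>2 \<le> (\<integral>t. t \<partial>scalar_measure E x)"
    by (rule integral_scalar_measure_ge[OF pvm_E _ 0(1) integrable_E]) auto
  ultimately show ?case by (simp add: left_diff_distrib)
next
  case (Suc n)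
  define c where "c = (a + b) / 2"
  have c: "a \<le> c" "c \<le> b" "c - a = (b - a) / 2" "b - c = (b - a) / 2"
    using Suc.prems by (auto simp: c_def field_simps)
  define y where "y = E {a<..c} x"
  define z where "z = x - E {a<..c} x"
  have oE: "orthogonal_projection (E {a<..c})" by (rule pvm_oproj[OF pvm_E]) simp
  have z: "z = E {c<..b} x"
    using pvm_Un_disjoint[OF pvm_E, of "{a<..c}" "{c<..b}" x] c Suc.prems(1)
    by (simp add: z_def ivl_disj_un ivl_disj_int algebra_simps)
  have "E {a<..c} y = y" "E {c<..b} z = z"
    by (simp_all add: y_def z oproj_idem[OF pvm_oproj[OF pvm_E]])
  then have "\<bar>rinner (X y) y - (\<integral>t. t \<partial>scalar_measure E y)\<bar> \<le> (b - a) / 2 ^ Suc n * (norm y)\<^sup>2"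
      "\<bar>rinner (X z) z - (\<integral>t. t \<partial>scalar_measure E z)\<bar> \<le> (b - a) / 2 ^ Suc n * (norm z)\<^sup>2"
    using Suc.IH[of a c y] Suc.IH[of c b z] c by simp_all
  moreover have "(\<integral>t. t \<partial>scalar_measure E x) = (\<integral>t. t \<partial>scalar_measure E y) + (\<integral>t. t \<partial>scalar_measure E z)"
    unfolding y_def z_def by (rule integral_scalar_measure_split[OF pvm_E _ integrable_E]) simp
  moreover have "rinner (X x) x = rinner (X y) y + rinner (X z) z"
  proof -
    have XE: "X (E {a<..c} w) = E {a<..c} (X w)" for w
      using c by (simp add: E_Ioc self_adjoint_diff[OF X] X_G)
    have "rinner (X y) z = 0"
      unfolding y_def z_def XE by (rule oproj_orth[OF oE])
    moreover have "rinner (X z) y = rinner (X y) z"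
      by (metis X rinner_commute self_adjoint_rinner)
    moreover have "x = y + z" by (simp add: y_def z_def)
    ultimately show ?thesis
      by (simp add: self_adjoint_add[OF X] rinner_simps)
  qed
  moreover have "(b - a) / 2 ^ Suc n * (norm x)\<^sup>2
      = (b - a) / 2 ^ Suc n * (norm y)\<^sup>2 + (b - a) / 2 ^ Suc n * (norm z)\<^sup>2"
    unfolding y_def z_def oproj_pythagoras[OF oE, of x] by (rule distrib_left)
  ultimately show ?case by linarith
qed

lemma spectral_measure_E: "spectral_measure_of X E"
  unfolding spectral_measure_of_def
proof (intro conjI allI)
  fix x :: 'a
  obtain K where K: "K > 0" "\<And>t x. t < - K \<Longrightarrow> G t x = 0" "\<And>t x. K \<le> t \<Longrightarrow> G t x = x"
    by (rule G_outside) blast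
  \<comment> \<open>\<open>2 * K + 1\<close> is the length of the interval from
    \<open>- (K + 1)\<close> to \<open>K\<close>, whose projection fixes every vector.\<close>
  define C where "C = (2 * K + 1) * (norm x)\<^sup>2"
  define d where "d = \<bar>rinner (X x) x - (\<integral>t. t \<partial>scalar_measure E x)\<bar>"
  have "d \<le> C * (1 / 2) ^ n" for n
    using form_defect_bound[of "- (K + 1)" K x n] K(1)
    by (simp add: E_Ioc K C_def d_def power_divide add_divide_distrib algebra_simps)
  moreover have "(\<lambda>n. C * (1 / 2) ^ n) \<longlonglongrightarrow> C * 0"
    by (intro tendsto_intros LIMSEQ_power_zero) auto
  ultimately have "d \<le> C * 0"
    by (intro LIMSEQ_le_const) auto
  then have "rinner (X x) x = (\<integral>t. t \<partial>scalar_measure E x)"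
    by (simp add: d_def)
  moreover have "Im (cinner (X x) x) = 0"
  proof -
    have "cinner (X x) x = cnj (cinner (X x) x)"
      using X by (metis cinner_commute self_adjoint_def)
    then show ?thesis by (metis add.inverse_neutral cnj.simps(2) equal_neg_zero)
  qed
  ultimately show "cinner (X x) x = complex_of_real (\<integral>t. t \<partial>scalar_measure E x)"
    by (simp add: complex_eq_iff rinner_def)
qed (rule pvm_E integrable_E)+

end

lemma spectral_measure_exists:
  assumes "self_adjoint X"
  obtains E where "spectral_measure_of X E"
  using spectral_family_exists[OF assms] spectral_family.spectral_measure_E by metis

text \<open>Every spectral measure yields a cut at \<open>b\<close> and cuts are unique, so the
  definite description may be evaluated with any spectral measure at hand.\<close>

lemma spectral_projection_eq:
  assumes X: "self_adjoint X" and E: "spectral_measure_of X E"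
  shows "spectral_projection X {..<b} = E {..<b}"
  unfolding spectral_projection_def
proof (rule the_equality)
  fix P assume "\<exists>E. spectral_measure_of X E \<and> P = E {..<b}"
  then obtain E' where E': "spectral_measure_of X E'" "P = E' {..<b}" by blast
  show "P = E {..<b}"
    unfolding E'(2)
    by (rule spec_cut_unique[OF X]; rule spectral_measure_cut[OF _ X])
       (use E E' in \<open>auto simp: spectral_measure_of_def\<close>)
qed (use E in blast)

section \<open>Precompact seminorms\<close>

text \<open>Total boundedness of the unit ball for \<open>p\<close>, phrased as a finite colouring
  in which points of equal colour are \<open>p\<close>-close. Colourings, unlike nets, pull back
  along contractions and combine by pairing.\<close>

definition precompact :: "('a::real_normed_vector \<Rightarrow> real) \<Rightarrow> bool" where
  "precompact p \<longleftrightarrow> (\<forall>e>0. \<exists>f::'a \<Rightarrow> nat. finite (f ` cball 0 1) \<and>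
     (\<forall>x\<in>cball 0 1. \<forall>y\<in>cball 0 1. f x = f y \<longrightarrow> p (x - y) \<le> e))"

lemma precompactE:
  assumes "precompact p" "e > 0"
  obtains f :: "'a::real_normed_vector \<Rightarrow> nat" where "finite (f ` cball 0 1)"
    "\<And>x y. x \<in> cball 0 1 \<Longrightarrow> y \<in> cball 0 1 \<Longrightarrow> f x = f y \<Longrightarrow> p (x - y) \<le> e"
  using assms unfolding precompact_def by metis

lemma precompact_mono:
  assumes p: "precompact p" and le: "\<And>x. q x \<le> c * p x" and c: "c \<ge> 0"
  shows "precompact q"
  unfolding precompact_def
proof (intro allI impI)
  fix e :: real assume "e > 0"
  then have "e / (c + 1) > 0" using c by simp
  from p this obtain f :: "'a \<Rightarrow> nat" where f: "finite (f ` cball 0 1)"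
    "\<And>x y. x \<in> cball 0 1 \<Longrightarrow> y \<in> cball 0 1 \<Longrightarrow> f x = f y \<Longrightarrow> p (x - y) \<le> e / (c + 1)"
    by (rule precompactE) blast
  have "q (x - y) \<le> e" if "x \<in> cball 0 1" "y \<in> cball 0 1" "f x = f y" for x y
  proof -
    have "q (x - y) \<le> c * (e / (c + 1))"
      using le[of "x - y"] mult_left_mono[OF f(2)[OF that] c] by linarith
    also have "\<dots> \<le> e"
      using c \<open>e > 0\<close> by (simp add: field_simps)
    finally show ?thesis .
  qed
  with f(1) show "\<exists>f::'a \<Rightarrow> nat. finite (f ` cball 0 1) \<and>
     (\<forall>x\<in>cball 0 1. \<forall>y\<in>cball 0 1. f x = f y \<longrightarrow> q (x - y) \<le> e)" by blast
qed

lemma finite_image_prod_encode: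
  assumes "finite (f ` A)" "finite (g ` A)"
  shows "finite ((\<lambda>x. prod_encode (f x, g x)) ` A)"
  by (rule finite_subset[of _ "prod_encode ` (f ` A \<times> g ` A)"]) (use assms in auto)

lemma precompact_add:
  assumes p: "precompact p" and q: "precompact q"
  shows "precompact (\<lambda>x. p x + q x)"
  unfolding precompact_def
proof (intro allI impI)
  fix e :: real assume "e > 0"
  then have e: "e / 2 > 0" by simp
  from p e obtain f :: "'a \<Rightarrow> nat" where f: "finite (f ` cball 0 1)"
    "\<And>x y. x \<in> cball 0 1 \<Longrightarrow> y \<in> cball 0 1 \<Longrightarrow> f x = f y \<Longrightarrow> p (x - y) \<le> e / 2"
    by (rule precompactE) blast
  from q e obtain g :: "'a \<Rightarrow> nat" where g: "finite (g ` cball 0 1)"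
    "\<And>x y. x \<in> cball 0 1 \<Longrightarrow> y \<in> cball 0 1 \<Longrightarrow> g x = g y \<Longrightarrow> q (x - y) \<le> e / 2"
    by (rule precompactE) blast
  show "\<exists>f::'a \<Rightarrow> nat. finite (f ` cball 0 1) \<and>
     (\<forall>x\<in>cball 0 1. \<forall>y\<in>cball 0 1. f x = f y \<longrightarrow> p (x - y) + q (x - y) \<le> e)"
  proof (intro exI[of _ "\<lambda>x. prod_encode (f x, g x)"] conjI ballI impI finite_image_prod_encode f g)
    fix x y :: 'a
    assume "x \<in> cball 0 1" "y \<in> cball 0 1" "prod_encode (f x, g x) = prod_encode (f y, g y)"
    then have "p (x - y) \<le> e / 2" "q (x - y) \<le> e / 2"
      using f(2)[of x y] g(2)[of x y] by (simp_all add: prod_encode_eq)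
    then show "p (x - y) + q (x - y) \<le> e" by simp
  qed
qed

lemma precompact_compose:
  fixes U :: "'a::real_normed_vector \<Rightarrow> 'b::real_normed_vector"
  assumes p: "precompact p" and U: "linear U" "\<And>x. norm (U x) \<le> norm x"
  shows "precompact (\<lambda>x. p (U x))"
  unfolding precompact_def
proof (intro allI impI)
  fix e :: real assume "e > 0"
  with p obtain f :: "'b \<Rightarrow> nat" where f: "finite (f ` cball 0 1)"
    "\<And>x y. x \<in> cball 0 1 \<Longrightarrow> y \<in> cball 0 1 \<Longrightarrow> f x = f y \<Longrightarrow> p (x - y) \<le> e"
    by (rule precompactE) blast
  have UB: "U x \<in> cball 0 1" if "x \<in> cball 0 1" for x
    using that U(2)[of x] by simp
  show "\<exists>f::'a \<Rightarrow> nat. finite (f ` cball 0 1) \<and>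
     (\<forall>x\<in>cball 0 1. \<forall>y\<in>cball 0 1. f x = f y \<longrightarrow> p (U (x - y)) \<le> e)"
  proof (intro exI[of _ "\<lambda>x. f (U x)"] conjI ballI impI)
    show "finite ((\<lambda>x. f (U x)) ` cball 0 1)"
      by (rule finite_subset[OF _ f(1)]) (use UB in auto)
  qed (use f(2) UB U(1) in \<open>simp add: linear_diff\<close>)
qed

lemma precompact_norm_if_compact:
  fixes A :: "'a::real_normed_vector \<Rightarrow> 'b::real_normed_vector"
  assumes diff: "\<And>x y. A (x - y) = A x - A y" and K: "compact K" "A ` cball 0 1 \<subseteq> K"
  shows "precompact (\<lambda>x. norm (A x))"
  unfolding precompact_def
proof (intro allI impI)
  fix e :: real assume "e > 0"
  then have "e / 2 > 0" by simp
  with K(1) obtain k where k: "finite k" "K \<subseteq> (\<Union>c\<in>k. ball c (e / 2))"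
    unfolding compact_eq_totally_bounded by blast
  have "\<exists>c\<in>k. A x \<in> ball c (e / 2)" if "x \<in> cball 0 1" for x
    using that k(2) K(2) by blast
  then obtain c where c: "\<And>x. x \<in> cball 0 1 \<Longrightarrow> c x \<in> k" "\<And>x. x \<in> cball 0 1 \<Longrightarrow> A x \<in> ball (c x) (e / 2)"
    by metis
  have "countable k" using k(1) by (rule countable_finite)
  show "\<exists>f::'a \<Rightarrow> nat. finite (f ` cball 0 1) \<and>
     (\<forall>x\<in>cball 0 1. \<forall>y\<in>cball 0 1. f x = f y \<longrightarrow> norm (A (x - y)) \<le> e)"
  proof (intro exI[of _ "\<lambda>x. to_nat_on k (c x)"] conjI ballI impI)
    show "finite ((\<lambda>x. to_nat_on k (c x)) ` cball 0 1)"
      by (rule finite_subset[of _ "to_nat_on k ` k"]) (use k(1) c(1) in auto)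
    fix x y :: 'a
    assume xy: "x \<in> cball 0 1" "y \<in> cball 0 1" "to_nat_on k (c x) = to_nat_on k (c y)"
    then have "c x = c y"
      using \<open>countable k\<close> c(1) by (metis to_nat_on_inj)
    then have "dist (A x) (A y) < e"
      using c(2)[OF xy(1)] c(2)[OF xy(2)] by (metis dist_commute dist_triangle_half_r mem_ball)
    then show "norm (A (x - y)) \<le> e"
      by (simp add: diff dist_norm)
  qed
qed

lemma precompact_compact_op:
  assumes "compact_op A"
  shows "precompact (\<lambda>x. norm (A x))"
proof (rule precompact_norm_if_compact)
  show "A (x - y) = A x - A y" for x y
    using assms unfolding compact_op_def linear_scaleC_iff by (metis diff_add_cancel add_diff_cancel)
  show "compact (closure (A ` cball 0 1))"
    using assms by (simp add: compact_op_def)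
qed (rule closure_subset)

lemma compact_op_if_precompact:
  assumes A: "self_adjoint A" and pre: "precompact (\<lambda>x. norm (A x))"
  shows "compact_op A"
  unfolding compact_op_def
proof (intro conjI allI impI)
  show "Vector_Spaces.linear scaleC scaleC A"
    using A by (simp add: self_adjoint_def bounded_op_def)
  note saA = self_adjointD[OF A]
  fix B :: "'a set" assume "bounded B"
  then obtain b where b: "b > 0" "\<And>x. x \<in> B \<Longrightarrow> norm x \<le> b"
    by (metis bounded_pos)
  have "\<exists>k. finite k \<and> closure (A ` B) \<subseteq> (\<Union>c\<in>k. ball c e)" if "e > 0" for e
  proof -
    \<comment> \<open>Scaling from the unit ball to radius \<open>b\<close> turns this into
      \<open>e / 2\<close>. The other half lets closed balls absorb the closure before they are
      enlarged to open ones.\<close>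
    have "e / (2 * b) > 0" using that b(1) by simp
    with pre obtain f :: "'a \<Rightarrow> nat" where f: "finite (f ` cball 0 1)"
      "\<And>x y. x \<in> cball 0 1 \<Longrightarrow> y \<in> cball 0 1 \<Longrightarrow> f x = f y \<Longrightarrow> norm (A (x - y)) \<le> e / (2 * b)"
      by (rule precompactE) blast
    define r where "r k = (SOME x. x \<in> cball 0 1 \<and> f x = k)" for k
    have r: "r (f x) \<in> cball 0 1" "f (r (f x)) = f x" if "x \<in> cball 0 1" for x
      unfolding r_def using someI_ex[of "\<lambda>y. y \<in> cball 0 1 \<and> f y = f x"] that by blast+
    define k where "k = (\<lambda>i. b *\<^sub>R A (r i)) ` (f ` cball 0 1)"
    have finite_k: "finite k" using f(1) by (simp add: k_def)
    have "A ` B \<subseteq> (\<Union>c\<in>k. cball c (e / 2))"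
    proof
      fix y assume "y \<in> A ` B"
      then obtain x where x: "x \<in> B" "y = A x" by blast
      define u where "u = (1 / b) *\<^sub>R x"
      have u: "u \<in> cball 0 1" "x = b *\<^sub>R u"
        using b(1) b(2)[OF x(1)] by (auto simp: u_def field_simps)
      have "norm (A (r (f u) - u)) \<le> e / (2 * b)"
        using r[OF u(1)] u(1) by (intro f(2)) auto
      moreover have "b *\<^sub>R A (r (f u)) - y = b *\<^sub>R A (r (f u) - u)"
        by (simp add: x(2) u(2) saA scaleR_right_diff_distrib)
      ultimately have "dist (b *\<^sub>R A (r (f u))) y \<le> e / 2"
        using b(1) by (simp add: dist_norm field_simps)
      then show "y \<in> (\<Union>c\<in>k. cball c (e / 2))"
        using u(1) by (auto simp: k_def)
    qed
    then have "closure (A ` B) \<subseteq> (\<Union>c\<in>k. cball c (e / 2))"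
      by (rule closure_minimal) (intro closed_UN finite_k ballI closed_cball)
    also have "\<dots> \<subseteq> (\<Union>c\<in>k. ball c e)"
      using that by (intro UN_mono) (auto simp: subset_eq)
    finally show ?thesis
      using finite_k by blast
  qed
  then show "compact (closure (A ` B))"
    by (simp add: compact_eq_totally_bounded complete_eq_closed)
qed

text \<open>The infimum \<open>r\<close> of the levels at which the unit ball has a finite \<open>p\<close>-small
  partition satisfies \<open>r \<le> \<rho> r\<close>.\<close>

lemma precompact_contraction:
  assumes q: "precompact q" and U: "linear U" "\<And>x. norm (U x) \<le> norm x"
    and le: "\<And>x. p x \<le> \<rho> * p (U x) + q x" and \<rho>: "0 \<le> \<rho>" "\<rho> < 1"
    and bound: "\<And>x. p x \<le> B * norm x"
  shows "precompact p"
proof -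
  define level where "level e \<longleftrightarrow> (\<exists>f::'a \<Rightarrow> nat. finite (f ` cball 0 1) \<and>
     (\<forall>x\<in>cball 0 1. \<forall>y\<in>cball 0 1. f x = f y \<longrightarrow> p (x - y) \<le> e))" for e
  \<comment> \<open>\<open>x\<close> is coloured by the colour of \<open>U x\<close> at level
    \<open>e\<close> together with its colour for \<open>q\<close> at level
    \<open>d\<close>.\<close>
  have step: "level (\<rho> * e + d)" if e: "level e" and "d > 0" for e d
  proof -
    from e obtain f :: "'a \<Rightarrow> nat" where f: "finite (f ` cball 0 1)"
      "\<And>x y. x \<in> cball 0 1 \<Longrightarrow> y \<in> cball 0 1 \<Longrightarrow> f x = f y \<Longrightarrow> p (x - y) \<le> e"
      unfolding level_def by blast
    from q \<open>d > 0\<close> obtain g :: "'a \<Rightarrow> nat" where g: "finite (g ` cball 0 1)"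
      "\<And>x y. x \<in> cball 0 1 \<Longrightarrow> y \<in> cball 0 1 \<Longrightarrow> g x = g y \<Longrightarrow> q (x - y) \<le> d"
      by (rule precompactE) blast
    have UB: "U x \<in> cball 0 1" if "x \<in> cball 0 1" for x
      using that U(2)[of x] by simp
    show ?thesis
      unfolding level_def
    proof (intro exI[of _ "\<lambda>x. prod_encode (f (U x), g x)"] conjI ballI impI finite_image_prod_encode g)
      show "finite ((\<lambda>x. f (U x)) ` cball 0 1)"
        by (rule finite_subset[OF _ f(1)]) (use UB in auto)
      fix x y :: 'a
      assume xy: "x \<in> cball 0 1" "y \<in> cball 0 1"
        "prod_encode (f (U x), g x) = prod_encode (f (U y), g y)"
      then have "p (U (x - y)) \<le> e" "q (x - y) \<le> d"
        using f(2)[OF UB UB, of x y] g(2)[of x y] by (simp_all add: prod_encode_eq linear_diff[OF U(1)])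
      then show "p (x - y) \<le> \<rho> * e + d"
        using le[of "x - y"] mult_left_mono[of "p (U (x - y))" e \<rho>] \<rho>(1) by linarith
    qed
  qed
  define C where "C = max 0 B * 2"
  have "level e" if "e > 0" for e
  proof -
    \<comment> \<open>With \<open>d = (1 - \<rho>) * (e / 2)\<close>, the passage from
      \<open>t\<close> to \<open>\<rho> * t + d\<close> has the fixed point \<open>e / 2\<close>, so
      the levels descend to it geometrically. \<open>C\<close> starts the descent from the diameter
      2 of the unit ball.\<close>
    have "level (\<rho> ^ n * C + e / 2)" for n
    proof (induction n)
      case 0
      have "p (x - y) \<le> C + e / 2" if "x \<in> cball 0 1" "y \<in> cball 0 1" for x y
      proof -
        have "norm (x - y) \<le> 2"
          using norm_triangle_ineq4[of x y] that by simp
        then have "max 0 B * norm (x - y) \<le> C"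
          unfolding C_def by (intro mult_left_mono) auto
        moreover have "B * norm (x - y) \<le> max 0 B * norm (x - y)"
          by (intro mult_right_mono) auto
        ultimately show ?thesis
          using bound[of "x - y"] \<open>e > 0\<close> by linarith
      qed
      then show ?case
        unfolding level_def by (intro exI[of _ "\<lambda>_. 0"]) (auto simp: image_constant_conv)
    next
      case (Suc n)
      have "\<rho> * (\<rho> ^ n * C + e / 2) + (1 - \<rho>) * (e / 2) = \<rho> ^ Suc n * C + e / 2"
        by (simp add: field_simps)
      with step[OF Suc, of "(1 - \<rho>) * (e / 2)"] \<rho> that show ?case by simp
    qed
    moreover have "(\<lambda>n. \<rho> ^ n * C) \<longlonglongrightarrow> 0 * C"
      using \<rho> by (intro tendsto_intros LIMSEQ_power_zero) auto
    then have "\<forall>\<^sub>F n in sequentially. \<rho> ^ n * C < e / 2"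
      using that by (intro order_tendstoD(2)) auto
    then obtain n where "\<rho> ^ n * C < e / 2"
      by (auto simp: eventually_sequentially)
    ultimately obtain d where "level d" "d \<le> e"
      by (metis add.commute add_le_cancel_left field_sum_of_halves less_imp_le)
    then show ?thesis
      unfolding level_def by (meson order_trans)
  qed
  then show ?thesis
    unfolding precompact_def level_def by blast
qed

section \<open>Projections of finite rank\<close>

lemma cmod_cinner_le: "cmod (cinner x y) \<le> 2 * norm x * norm y"
  using cmod_le[of "cinner x y"] abs_rinner_le_norm[of x y] abs_rinner_le_norm[of x "\<i> *\<^sub>C y"]
  by (simp add: norm_scaleC cinner_eq_rinner)

lemma precompact_cinner: "precompact (\<lambda>x. cmod (cinner x c))"
proof (rule precompact_norm_if_compact)
  show "cinner (x - y) c = cinner x c - cinner y c" for x y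
    by (simp add: cinner_eq_rinner complex_eq_iff rinner.diff_left)
  show "(\<lambda>x. cinner x c) ` cball 0 1 \<subseteq> cball 0 (2 * norm c)"
  proof
    fix z assume "z \<in> (\<lambda>x. cinner x c) ` cball 0 1"
    then obtain x where "z = cinner x c" "norm x \<le> 1" by auto
    then show "z \<in> cball 0 (2 * norm c)"
      using cmod_cinner_le[of x c] mult_right_mono[of "norm x" 1 "norm c"] by simp
  qed
qed simp

lemma range_oproj: "orthogonal_projection P \<Longrightarrow> range P = {x. P x = x}"
  using oproj_idem[of P] by (auto intro: range_eqI[OF sym])

lemma subspace_range_oproj: "orthogonal_projection P \<Longrightarrow> complex_vector.subspace (range P)"
  by (simp add: range_oproj complex_vector.subspace_def self_adjointD[OF oproj_self_adjoint])

text \<open>Gram-Schmidt: the component \<open>c\<close> of \<open>b\<close> orthogonal to the span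
  so far contributes a rank one projection, whose norm is a multiple of the modulus of one bounded
  functional and hence precompact.\<close>

lemma oproj_span:
  assumes "finite B"
  shows "\<exists>P. orthogonal_projection P \<and> range P = complex_vector.span B \<and> precompact (\<lambda>x. norm (P x))"
  using assms
proof (induction B)
  case empty
  have "precompact (\<lambda>x::'a. norm (0::'a))"
    unfolding precompact_def by (intro allI impI exI[of _ "\<lambda>_. 0"]) (auto simp: image_constant_conv)
  then show ?case
    by (intro exI[of _ "\<lambda>x. 0"]) (simp add: oproj_zero)
next
  case (insert b B)
  then obtain P where P: "orthogonal_projection P" "range P = complex_vector.span B"
    "precompact (\<lambda>x. norm (P x))" by blast
  note saP = self_adjointD[OF oproj_self_adjoint[OF P(1)]]
  define c where "c = b - P b"
  have Pc: "P c = 0" by (simp add: c_def saP oproj_idem[OF P(1)])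
  show ?case
  proof (cases "c = 0")
    case True
    then have "b \<in> complex_vector.span B"
      using P(2) by (metis c_def eq_iff_diff_eq_0 rangeI)
    then show ?thesis
      using P by (intro exI[of _ P]) (simp add: complex_vector.span_redundant)
  next
    case False
    define Q where "Q x = (cinner x c / (norm c)\<^sup>2) *\<^sub>C c" for x
    have add: "Q (x + y) = Q x + Q y" for x y
      by (simp add: Q_def cinner_add_left add_divide_distrib scaleC_add_left)
    have sc: "Q (a *\<^sub>C x) = a *\<^sub>C Q x" for a x
      by (simp add: Q_def cinner_scaleC_left scaleC_scaleC)
    have normQ: "norm (Q x) = (1 / norm c) * cmod (cinner x c)" for x
      by (simp add: Q_def norm_scaleC norm_divide norm_mult power2_eq_square)
    have Qc: "Q c = c"
      using False by (simp add: Q_def scaleC_one flip: power2_norm_eq_cinner)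
    have QQ: "Q (Q x) = Q x" for x
      unfolding Q_def[of x] sc Qc ..
    have "bounded_op Q"
      unfolding bounded_op_def linear_scaleC_iff
    proof (intro conjI allI add sc exI)
      fix x
      have "norm (Q x) \<le> (1 / norm c) * (2 * norm x * norm c)"
        unfolding normQ by (intro mult_left_mono cmod_cinner_le) simp
      then show "norm (Q x) \<le> 2 * norm x" using False by simp
    qed
    moreover have "cinner (Q x) y = cinner x (Q y)" for x y
      using cinner_commute[of c y] by (simp add: Q_def cinner_scaleC_left cinner_scaleC_right)
    ultimately have oQ: "orthogonal_projection Q"
      by (simp add: orthogonal_projection_iff self_adjoint_def QQ)
    have PQ: "P (Q x) = 0" for x
      by (simp add: Q_def saP Pc)
    define R where "R x = P x + Q x" for x
    have oR: "orthogonal_projection R"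
      unfolding R_def by (rule oproj_add[OF P(1) oQ PQ])
    have QP: "Q (P x) = 0" for x
      by (rule rinner_eqI)
         (simp add: self_adjoint_rinner[OF oproj_self_adjoint[OF oQ]] saP PQ rinner.zero_left rinner.zero_right)
    have "range R = complex_vector.span (insert b B)"
    proof
      have B: "complex_vector.span B \<subseteq> complex_vector.span (insert b B)"
        by (rule complex_vector.span_mono) auto
      then have Pspan: "P x \<in> complex_vector.span (insert b B)" for x
        using P(2) by blast
      have "c \<in> complex_vector.span (insert b B)"
        unfolding c_def by (rule complex_vector.span_diff[OF complex_vector.span_base Pspan]) simp
      with Pspan show "range R \<subseteq> complex_vector.span (insert b B)"
        by (auto simp: R_def Q_def intro!: complex_vector.span_add complex_vector.span_scale)
      have "R v = v" if "v \<in> B" for v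
      proof -
        have "P v = v"
          using that P(2) range_oproj[OF P(1)] complex_vector.span_base by blast
        then show ?thesis using QP[of v] by (simp add: R_def)
      qed
      moreover have "R b = b"
      proof -
        have "Q b = Q c" unfolding c_def self_adjoint_diff[OF oproj_self_adjoint[OF oQ]] QP by simp
        then show ?thesis by (simp add: R_def Qc) (simp add: c_def)
      qed
      ultimately show "complex_vector.span (insert b B) \<subseteq> range R"
        by (intro complex_vector.span_minimal subspace_range_oproj oR) (auto simp: range_oproj[OF oR])
    qed
    moreover have "precompact (\<lambda>x. norm (R x))"
    proof (rule precompact_mono[where c=1])
      show "precompact (\<lambda>x. norm (P x) + norm (Q x))"
        by (intro precompact_add P(3) precompact_mono[OF precompact_cinner[of c], where c="1 / norm c"])
           (simp_all add: normQ)
    qed (simp_all add: R_def norm_triangle_ineq)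
    ultimately show ?thesis using oR by blast
  qed
qed

lemma precompact_if_range_subset:
  assumes Q: "orthogonal_projection Q" and V: "finite_dim V" "range Q \<subseteq> V"
  shows "precompact (\<lambda>x. norm (Q x))"
proof -
  obtain B where "finite B" "complex_vector.span B = V"
    using V(1) by (auto simp: finite_dim_def)
  then obtain P where P: "orthogonal_projection P" "range P = V" "precompact (\<lambda>x. norm (P x))"
    using oproj_span by metis
  have "P (Q x) = Q x" for x
    using V(2) P(2) range_oproj[OF P(1)] by auto
  with precompact_compose[OF P(3) bounded_linear.linear[OF self_adjoint_bounded_linear[OF oproj_self_adjoint[OF Q]]] oproj_norm_le[OF Q]]
  show ?thesis by simp
qed

text \<open>F. Riesz: a unit vector of the range of \<open>Q\<close> orthogonal to a finite net of the image of the
  unit ball has distance at least \<open>1\<close> from the net.\<close>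

lemma finite_dim_range_if_precompact:
  assumes Q: "orthogonal_projection Q" and pre: "precompact (\<lambda>x. norm (Q x))"
  shows "finite_dim (range Q)"
proof -
  note saQ = self_adjointD[OF oproj_self_adjoint[OF Q]]
  obtain f :: "'a \<Rightarrow> nat" where f: "finite (f ` cball 0 1)"
    "\<And>x y. x \<in> cball 0 1 \<Longrightarrow> y \<in> cball 0 1 \<Longrightarrow> f x = f y \<Longrightarrow> norm (Q (x - y)) \<le> 1 / 2"
    by (rule precompactE[OF pre, of "1 / 2"]) auto
  define r where "r k = (SOME x. x \<in> cball 0 1 \<and> f x = k)" for k
  have r: "r (f x) \<in> cball 0 1" "f (r (f x)) = f x" if "x \<in> cball 0 1" for x
    unfolding r_def using someI_ex[of "\<lambda>y. y \<in> cball 0 1 \<and> f y = f x"] that by blast+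
  define N where "N = (\<lambda>k. Q (r k)) ` (f ` cball 0 1)"
  have N: "finite N" using f(1) by (simp add: N_def)
  then obtain P where P: "orthogonal_projection P" "range P = complex_vector.span N"
    using oproj_span by metis
  note saP = self_adjointD[OF oproj_self_adjoint[OF P(1)]]
  have NQ: "complex_vector.span N \<subseteq> range Q"
    by (intro complex_vector.span_minimal subspace_range_oproj Q) (auto simp: N_def)
  have "x \<in> complex_vector.span N" if x: "Q x = x" for x
  proof (rule ccontr)
    assume nx: "x \<notin> complex_vector.span N"
    define w where "w = x - P x"
    have w: "w \<noteq> 0"
      using nx P(2) by (metis eq_iff_diff_eq_0 rangeI w_def)
    have "Q (P x) = P x"
      using NQ P(2) range_oproj[OF Q] by auto
    then have Qw: "Q w = w" by (simp add: w_def saQ x)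
    define e where "e = (1 / norm w) *\<^sub>R w"
    have e: "norm e = 1" "Q e = e"
      using w by (simp_all add: e_def saQ Qw)
    then have eB: "e \<in> cball 0 1" by simp
    define y where "y = Q (r (f e))"
    have "y \<in> N" using eB by (simp add: y_def N_def)
    then have "P y = y"
      using P(2) complex_vector.span_base range_oproj[OF P(1)] by blast
    then have "rinner e y = 0"
      using oproj_orth[OF P(1), of y x]
      by (simp add: e_def w_def rinner.scaleR_right rinner_commute[of _ y])
    then have "1 \<le> (norm (e - y))\<^sup>2"
      by (simp add: power2_norm_diff e)
    moreover have "norm (e - y) \<le> 1 / 2"
      using f(2)[OF eB r(1)[OF eB]] r(2)[OF eB] by (simp add: y_def saQ e)
    then have "(norm (e - y))\<^sup>2 \<le> (1 / 2)\<^sup>2"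
      by (intro power_mono) auto
    ultimately show False by (simp add: power2_eq_square)
  qed
  then have "range Q = complex_vector.span N"
    using NQ range_oproj[OF Q] by auto
  with N show ?thesis by (auto simp: finite_dim_def)
qed

section \<open>Differences of spectral projections\<close>

text \<open>The norm of a self-adjoint operator is its numerical radius, here on a reducing
  subspace. Polarization is applied to \<open>x\<close> and the multiple \<open>y\<close> of
  \<open>T x\<close> of the same length as \<open>x\<close>, followed by the parallelogram
  law.\<close>

lemma norm_le_if_form_bounded:
  assumes T: "self_adjoint T" and Q: "orthogonal_projection Q" "\<And>x. T (Q x) = Q (T x)"
    and form: "\<And>x. Q x = x \<Longrightarrow> \<bar>rinner (T x) x\<bar> \<le> r * (norm x)\<^sup>2" and x: "Q x = x"
  shows "norm (T x) \<le> r * norm x"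
proof (cases "T x = 0 \<or> x = 0")
  case True
  have "0 \<le> r * (norm x)\<^sup>2" using form[OF x] by linarith
  with True show ?thesis
    by (auto simp: self_adjoint_zero[OF T] zero_le_mult_iff)
next
  case False
  note saT = self_adjointD[OF T] and saQ = self_adjointD[OF oproj_self_adjoint[OF Q(1)]]
  define y where "y = (norm x / norm (T x)) *\<^sub>R T x"
  have y: "Q y = y" "norm y = norm x"
    using False Q(2)[of x] by (simp_all add: y_def saQ x)
  have "rinner (T x) y = norm x * norm (T x)"
    using False by (simp add: y_def rinner_simps rinner_self power2_eq_square)
  moreover have "rinner (T y) x = rinner (T x) y"
    by (metis T rinner_commute self_adjoint_rinner)
  ultimately have "4 * (norm x * norm (T x)) = rinner (T (x + y)) (x + y) - rinner (T (x - y)) (x - y)"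
    by (simp add: saT rinner_simps)
  also have "\<dots> \<le> r * (norm (x + y))\<^sup>2 + r * (norm (x - y))\<^sup>2"
    using form[of "x + y"] form[of "x - y"] by (simp add: saQ x y)
  also have "\<dots> = r * (2 * (norm x)\<^sup>2 + 2 * (norm y)\<^sup>2)"
    by (simp add: power2_norm_add power2_norm_diff algebra_simps)
  finally have "norm x * norm (T x) \<le> norm x * (r * norm x)"
    by (simp add: y power2_eq_square mult_ac)
  then show ?thesis using False by simp
qed

text \<open>Rosenblum's argument: \<open>K = R Q\<close> satisfies \<open>T' K = K T + R (T' - T) Q\<close>. After a shift, \<open>T\<close> is
  smaller on the range of \<open>Q\<close> than \<open>T'\<close> is on the range of \<open>R\<close>, so that \<open>K\<close> is a
  contraction of itself modulo a compact term.\<close>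

lemma precompact_separated:
  assumes T: "self_adjoint T" and T': "self_adjoint T'"
    and pre: "precompact (\<lambda>x. norm (T' x - T x))"
    and Q: "orthogonal_projection Q" "\<And>x. T (Q x) = Q (T x)"
    and R: "orthogonal_projection R" "\<And>x. T' (R x) = R (T' x)"
    and le: "\<And>x. Q x = x \<Longrightarrow> rinner (T x) x \<le> a * (norm x)\<^sup>2"
    and ge: "\<And>x. R x = x \<Longrightarrow> b * (norm x)\<^sup>2 \<le> rinner (T' x) x" and "a < b"
  shows "precompact (\<lambda>x. norm (R (Q x)))"
proof -
  note saT = self_adjointD[OF T] and saT' = self_adjointD[OF T']
  note saQ = self_adjointD[OF oproj_self_adjoint[OF Q(1)]] and saR = self_adjointD[OF oproj_self_adjoint[OF R(1)]]
  obtain M where M: "M > 0" "\<And>x. norm (T x) \<le> M * norm x"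
    by (rule self_adjoint_bound[OF T]) blast
  \<comment> \<open>\<open>s \<ge> M\<close> makes \<open>T + s\<close> positive, so the upper bound
    \<open>a + s\<close> of its form on the range of \<open>Q\<close> is also a norm bound; the
    remaining summands make \<open>a + s\<close> positive.\<close>
  define s where "s = M + \<bar>a\<bar> + 1"
  have s: "a + s > 0" "b + s > 0" "M \<le> s"
    using M(1) \<open>a < b\<close> by (auto simp: s_def)
  define B where "B x = T x + s *\<^sub>R x" for x
  have B: "self_adjoint B"
    using self_adjoint_shift[OF T, of "-s"] by (simp add: B_def[abs_def])
  have BQ: "B (Q x) = Q (B x)" for x
    by (simp add: B_def saQ Q(2))
  have B_le: "norm (B (Q x)) \<le> (a + s) * norm x" for x
  proof -
    have "norm (B (Q x)) \<le> (a + s) * norm (Q x)"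
    proof (rule norm_le_if_form_bounded[OF B Q(1) BQ])
      fix x assume "Q x = x"
      have "\<bar>rinner (T x) x\<bar> \<le> M * (norm x)\<^sup>2"
        using abs_rinner_le_norm[of "T x" x] mult_right_mono[OF M(2)[of x], of "norm x"]
        by (simp add: power2_eq_square mult.assoc)
      moreover have "M * (norm x)\<^sup>2 \<le> s * (norm x)\<^sup>2"
        using s by (intro mult_right_mono) auto
      ultimately show "\<bar>rinner (B x) x\<bar> \<le> (a + s) * (norm x)\<^sup>2"
        using le[OF \<open>Q x = x\<close>] by (simp add: B_def rinner_simps rinner_self distrib_right)
    qed (rule oproj_idem[OF Q(1)])
    also have "\<dots> \<le> (a + s) * norm x"
      using s by (intro mult_left_mono oproj_norm_le[OF Q(1)]) auto
    finally show ?thesis .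
  qed
  define U where "U x = (1 / (a + s)) *\<^sub>R B (Q x)" for x
  have U: "linear U" "\<And>x. norm (U x) \<le> norm x"
  proof -
    have "bounded_linear (\<lambda>x. B (Q x))"
      using bounded_linear_compose[OF self_adjoint_bounded_linear[OF B] saQ(1)] .
    then show "linear U"
      unfolding U_def by (intro bounded_linear.linear bounded_linear_const_scaleR)
    show "norm (U x) \<le> norm x" for x
      using B_le[of x] s by (simp add: U_def field_simps)
  qed
  show ?thesis
  proof (rule precompact_contraction[OF _ U])
    have "precompact (\<lambda>x. norm (T' (Q x) - T (Q x)))"
      by (rule precompact_compose[OF pre bounded_linear.linear[OF saQ(1)] oproj_norm_le[OF Q(1)]])
    then show "precompact (\<lambda>x. (1 / (b + s)) * norm (T' (Q x) - T (Q x)))"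
      by (rule precompact_mono[where c = "1 / (b + s)"]) (use s in auto)
    show "0 \<le> (a + s) / (b + s)" "(a + s) / (b + s) < 1"
      using s \<open>a < b\<close> by auto
    fix x
    show "norm (R (Q x)) \<le> 1 * norm x"
      using oproj_norm_le[OF R(1), of "Q x"] oproj_norm_le[OF Q(1), of x] by simp
    define y where "y = R (Q x)"
    have Ry: "R y = y" by (simp add: y_def oproj_idem[OF R(1)])
    have "(b + s) * (norm y)\<^sup>2 \<le> rinner (T' y + s *\<^sub>R y) y"
      using ge[OF Ry] by (simp add: rinner_simps rinner_self distrib_right)
    also have "\<dots> \<le> norm (T' y + s *\<^sub>R y) * norm y"
      by (rule rinner_le_norm)
    finally have "(b + s) * norm y \<le> norm (T' y + s *\<^sub>R y)"
      by (cases "y = 0") (auto simp: power2_eq_square)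
    \<comment> \<open>Since \<open>R\<close> commutes with \<open>T'\<close>, shifting both
      operators gives \<open>(T' + s) R Q = R (T + s) Q + R (T' - T) Q\<close>. The next line writes
      \<open>(T + s) Q\<close> as \<open>(a + s) Q U\<close>, so that \<open>R Q\<close> reappears
      evaluated at \<open>U x\<close>.\<close>
    also have "T' y + s *\<^sub>R y = R (B (Q x)) + R (T' (Q x) - T (Q x))"
      by (simp add: y_def B_def saR R(2))
    also have "B (Q x) = (a + s) *\<^sub>R Q (U x)"
      using s by (simp add: U_def saQ BQ oproj_idem[OF Q(1)])
    also have "norm (R ((a + s) *\<^sub>R Q (U x)) + R (T' (Q x) - T (Q x)))
        \<le> (a + s) * norm (R (Q (U x))) + norm (T' (Q x) - T (Q x))"
      using s oproj_norm_le[OF R(1), of "T' (Q x) - T (Q x)"]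
        norm_triangle_ineq[of "R ((a + s) *\<^sub>R Q (U x))" "R (T' (Q x) - T (Q x))"]
      by (simp add: saR(7))
    finally have "norm y \<le> ((a + s) * norm (R (Q (U x))) + norm (T' (Q x) - T (Q x))) / (b + s)"
      using s by (simp add: pos_le_divide_eq mult.commute)
    then show "norm (R (Q x))
        \<le> (a + s) / (b + s) * norm (R (Q (U x))) + 1 / (b + s) * norm (T' (Q x) - T (Q x))"
      by (simp add: y_def add_divide_distrib distrib_right)
  qed
qed

section \<open>Resolvent and essential spectrum in terms of the spectral measure\<close>

context
  fixes X :: "'a::complex_hilbert_space \<Rightarrow> 'a" and E :: "real set \<Rightarrow> 'a \<Rightarrow> 'a"
  assumes X: "self_adjoint X" and sm: "spectral_measure_of X E"
begin

lemma spectral_measure_pvm: "projection_valued_measure E"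
  using sm by (simp add: spectral_measure_of_def)

lemmas E_oproj = pvm_oproj[OF spectral_measure_pvm]
  and E_mult = pvm_mult[OF spectral_measure_pvm]
  and E_compl = pvm_compl[OF spectral_measure_pvm]
  and E_Un = pvm_Un_disjoint[OF spectral_measure_pvm]
  and E_commute = spectral_measure_commute[OF spectral_measure_pvm X sm]
  and E_form_le = spectral_measure_le[OF spectral_measure_pvm X sm]
  and E_form_ge = spectral_measure_ge[OF spectral_measure_pvm X sm]

lemma norm_spectral_measure_le:
  assumes A: "A \<in> sets borel" "A \<subseteq> {c - e..c + e}" and x: "E A x = x"
  shows "norm (X x - c *\<^sub>R x) \<le> e * norm x"
proof (rule norm_le_if_form_bounded[OF self_adjoint_shift[OF X] E_oproj[OF A(1)] _ _ x])
  note saE = self_adjointD[OF oproj_self_adjoint[OF E_oproj[OF A(1)]]]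
  show "X (E A x) - c *\<^sub>R E A x = E A (X x - c *\<^sub>R x)" for x
    by (simp add: saE E_commute A(1))
  show "\<bar>rinner (X x - c *\<^sub>R x) x\<bar> \<le> e * (norm x)\<^sup>2" if "E A x = x" for x
  proof -
    have "A \<subseteq> {..c + e}" "A \<subseteq> {c - e..}" using A(2) by auto
    then show ?thesis
      using E_form_le[OF A(1) _ that, of "c + e"] E_form_ge[OF A(1) _ that, of "c - e"]
      by (simp add: rinner_simps rinner_self algebra_simps abs_le_iff)
  qed
qed

text \<open>On the range of the projection for the interval, \<open>X - t\<close> has norm at most
  \<open>e\<close>, while an inverse bounded by \<open>K\<close> gives
  \<open>norm y \<le> K * e * norm y\<close>. The choice of \<open>e\<close> makes
  \<open>K * e\<close> equal to 1/2.\<close>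

lemma spectral_measure_resolvent:
  assumes "complex_of_real t \<notin> spectrum X"
  obtains e where "e > 0" "\<And>x. E {t - e<..<t + e} x = 0"
proof -
  from assms obtain R where R: "bounded_op R" "\<And>x. R (X x - complex_of_real t *\<^sub>C x) = x"
    by (auto simp: spectrum_def resolvent_set_def)
  then obtain K where K: "K > 0" "\<And>x. norm (R x) \<le> K * norm x"
    using bounded_linear.pos_bounded[of R] by (auto simp: bounded_op_iff mult.commute)
  define e where "e = 1 / (2 * K)"
  have e: "e > 0" using K(1) by (simp add: e_def)
  show ?thesis
  proof (rule that[OF e])
    fix x
    define y where "y = E {t - e<..<t + e} x"
    have "E {t - e<..<t + e} y = y"
      by (simp add: y_def oproj_idem[OF E_oproj])
    then have "norm (X y - t *\<^sub>R y) \<le> e * norm y"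
      by (intro norm_spectral_measure_le) auto
    moreover have "norm y \<le> K * norm (X y - t *\<^sub>R y)"
      using K(2)[of "X y - t *\<^sub>R y"] R(2)[of y] by (simp add: scaleC_of_real)
    ultimately have "norm y \<le> K * (e * norm y)"
      using K(1) by (meson mult_left_mono less_imp_le order_trans)
    then show "E {t - e<..<t + e} x = 0"
      using K(1) by (simp add: e_def y_def)
  qed
qed

text \<open>Every point of \<open>U\<close> has a neighbourhood with zero projection, and Lindelof's
  theorem selects countably many of these, so that countable additivity applies.\<close>

lemma spectral_measure_open_resolvent:
  assumes U: "open U" and res: "\<And>t. t \<in> U \<Longrightarrow> complex_of_real t \<notin> spectrum X"
  shows "E U x = 0"
proof -
  define \<F> where "\<F> = {{t - e<..<t + e} | t e. e > 0 \<and> (\<forall>x. E {t - e<..<t + e} x = 0)}"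
  have "open B" if "B \<in> \<F>" for B using that by (auto simp: \<F>_def)
  then obtain \<F>' where F': "\<F>' \<subseteq> \<F>" "countable \<F>'" "\<Union>\<F>' = \<Union>\<F>"
    by (rule Lindelof)
  have "(\<Union>B\<in>\<F>'. B) \<in> null_sets (scalar_measure E x)"
  proof (rule null_sets_UN'[OF F'(2)])
    fix B assume "B \<in> \<F>'"
    then have "B \<in> sets borel" "E B x = 0" using F'(1) by (auto simp: \<F>_def)
    then show "B \<in> null_sets (scalar_measure E x)"
      by (auto simp: null_sets_def emeasure_scalar_measure[OF spectral_measure_pvm]
          sets_scalar_measure[OF spectral_measure_pvm])
  qed
  moreover have "U \<subseteq> (\<Union>B\<in>\<F>'. B)"
  proof
    fix t assume "t \<in> U"
    from spectral_measure_resolvent[OF res[OF this]] obtain e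
      where "e > 0" "\<And>x. E {t - e<..<t + e} x = 0" by metis
    then have "{t - e<..<t + e} \<in> \<F>" "t \<in> {t - e<..<t + e}"
      by (auto simp: \<F>_def)
    then have "t \<in> \<Union>\<F>" by blast
    then show "t \<in> (\<Union>B\<in>\<F>'. B)" using F'(3) by simp
  qed
  ultimately have "U \<in> null_sets (scalar_measure E x)"
    using U by (elim null_sets_subset) (simp_all add: sets_scalar_measure[OF spectral_measure_pvm])
  then show ?thesis
    using U by (simp add: null_sets_def emeasure_scalar_measure[OF spectral_measure_pvm])
qed

text \<open>Near a resolvent point the projection vanishes. Near an isolated point of the spectrum
  it reduces to \<open>E {lam}\<close>, whose range consists of eigenvectors.\<close>

lemma finite_rank_if_not_ess_spectrum:
  assumes "complex_of_real lam \<notin> ess_spectrum X"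
  obtains e where "e > 0" "precompact (\<lambda>x. norm (E {lam - e..<lam + e} x))"
proof (cases "complex_of_real lam \<in> spectrum X")
  case False
  then obtain e where e: "e > 0" "\<And>x. E {lam - e<..<lam + e} x = 0"
    using spectral_measure_resolvent by metis
  \<comment> \<open>The half-open interval contains its left end, so it is shrunk to fit into the
    open one; \<open>e = d / 2\<close> below has the same purpose.\<close>
  have "E {lam - e / 2..<lam + e / 2} x = 0" for x
  proof -
    have "{lam - e<..<lam + e} \<inter> {lam - e / 2..<lam + e / 2} = {lam - e / 2..<lam + e / 2}"
      using e(1) by auto
    then show ?thesis
      using E_mult[of "{lam - e<..<lam + e}" "{lam - e / 2..<lam + e / 2}" x] e(2) by simp
  qed
  moreover have "precompact (\<lambda>x::'a. norm (0::'a))"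
    unfolding precompact_def by (intro allI impI exI[of _ "\<lambda>_. 0"]) (auto simp: image_constant_conv)
  ultimately show ?thesis
    using e(1) by (intro that[of "e / 2"]) simp_all
next
  case True
  then have "complex_of_real lam isolated_in spectrum X"
    and fin: "finite_dim (eigenspace X (complex_of_real lam))"
    using assms by (auto simp: ess_spectrum_def discrete_spectrum_def)
  then obtain W where W: "open W" "W \<inter> spectrum X = {complex_of_real lam}"
    unfolding isolated_in_def by blast
  then obtain d where d: "d > 0" "ball (complex_of_real lam) d \<subseteq> W"
    by (metis IntE insertI1 open_contains_ball)
  define e where "e = d / 2"
  have e: "e > 0" using d(1) by (simp add: e_def)
  let ?A = "{lam - e..<lam + e}" and ?U = "{lam - d<..<lam + d} - {lam}"
  have res: "complex_of_real t \<notin> spectrum X" if "t \<in> ?U" for t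
  proof
    assume "complex_of_real t \<in> spectrum X"
    moreover have "complex_of_real t \<in> ball (complex_of_real lam) d"
      using that by (auto simp: dist_real_def)
    ultimately have "complex_of_real t = complex_of_real lam"
      using W(2) d(2) by blast
    with that show False by simp
  qed
  have U: "E ?U x = 0" for x
    by (rule spectral_measure_open_resolvent[OF _ res]) auto
  have A: "E ?A x = E {lam} x" for x
  proof -
    have *: "?U \<inter> (?A - {lam}) = ?A - {lam}" "{lam} \<union> (?A - {lam}) = ?A"
      using e by (auto simp: e_def)
    then have "E (?A - {lam}) x = 0"
      using E_mult[of ?U "?A - {lam}" x] U by simp
    then show ?thesis
      using E_Un[of "{lam}" "?A - {lam}" x] * by simp
  qed
  have "range (E {lam}) \<subseteq> eigenspace X (complex_of_real lam)"
  proof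
    fix y assume "y \<in> range (E {lam})"
    then have "E {lam} y = y"
      using range_oproj[OF E_oproj, of "{lam}"] by auto
    then have "norm (X y - lam *\<^sub>R y) \<le> 0 * norm y"
      by (intro norm_spectral_measure_le[of "{lam}"]) auto
    then show "y \<in> eigenspace X (complex_of_real lam)"
      by (simp add: eigenspace_def scaleC_of_real)
  qed
  then have "precompact (\<lambda>x. norm (E ?A x))"
    unfolding A by (intro precompact_if_range_subset[OF E_oproj fin]) auto
  with e show ?thesis by (rule that)
qed

text \<open>Off a small interval around 0, \<open>X\<close> is bounded below by \<open>e\<close>, so
  that part of \<open>Q x\<close> is controlled by \<open>X (Q x)\<close>. The part inside the
  interval is precompact.\<close>

lemma not_ess_spectrum_zero:
  assumes "0 \<notin> ess_spectrum X" and Q: "orthogonal_projection Q"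
    and pre: "precompact (\<lambda>x. norm (X (Q x)))"
  shows "precompact (\<lambda>x. norm (Q x))"
proof -
  obtain e where e: "e > 0" "precompact (\<lambda>x. norm (E {0 - e..<0 + e} x))"
    by (rule finite_rank_if_not_ess_spectrum[of 0]) (use assms in auto)
  define A where "A = {- e..<e}"
  have A: "A \<in> sets borel" by (simp add: A_def)
  note oA = E_oproj[OF A]
  note saA = self_adjointD[OF oproj_self_adjoint[OF oA]]
  have preA: "precompact (\<lambda>x. norm (E A (Q x)))"
    using precompact_compose[OF e(2) bounded_linear.linear[OF self_adjoint_bounded_linear[OF oproj_self_adjoint[OF Q]]] oproj_norm_le[OF Q]]
    by (simp add: A_def)
  \<comment> \<open>The form is at least \<open>e\<close> on the positive part \<open>u\<close> and
    at most \<open>- e\<close> on the negative part \<open>v\<close>. \<open>X\<close> keeps the two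
    parts orthogonal, so the bounds add up in squares.\<close>
  have below: "e * norm y \<le> norm (X y)" if "E A y = 0" for y
  proof -
    define u where "u = E {e..} y"
    define v where "v = E {..<-e} y"
    have y: "y = u + v"
    proof -
      have "- A = {e..} \<union> {..<-e}" "{e..} \<inter> {..<-e} = {}" using e(1) by (auto simp: A_def)
      then show ?thesis
        using E_compl[OF A, of y] E_Un[of "{e..}" "{..<-e}" y] that by (simp add: u_def v_def)
    qed
    have uu: "E {e..} u = u" and vv: "E {..<-e} v = v"
      by (simp_all add: u_def v_def oproj_idem[OF E_oproj])
    have uv: "E {e..} v = 0"
    proof -
      have "{e..} \<inter> {..<-e} = {}" using e(1) by auto
      then show ?thesis
        by (simp add: v_def E_mult pvm_empty[OF spectral_measure_pvm])
    qed
    have low: "e * norm w \<le> norm (X w)" if "e * (norm w)\<^sup>2 \<le> \<bar>rinner (X w) w\<bar>" for w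
    proof -
      have "e * norm w * norm w \<le> norm (X w) * norm w"
        using that abs_rinner_le_norm[of "X w" w] by (simp add: power2_eq_square)
      then show ?thesis by (cases "w = 0") auto
    qed
    have "e * norm u \<le> norm (X u)"
      using E_form_ge[of "{e..}" e u] uu by (intro low) simp
    moreover have "e * norm v \<le> norm (X v)"
      using E_form_le[of "{..<-e}" "-e" v] vv by (intro low) (simp add: less_imp_le subset_eq)
    ultimately have "(e * norm u)\<^sup>2 + (e * norm v)\<^sup>2 \<le> (norm (X u))\<^sup>2 + (norm (X v))\<^sup>2"
      using e(1) by (intro add_mono power_mono) auto
    moreover have orth: "(norm (a + b))\<^sup>2 = (norm a)\<^sup>2 + (norm b)\<^sup>2"
      if "E {e..} a = a" "E {e..} b = 0" for a b
      using oproj_orth[OF E_oproj, of "{e..}" a b] that by (simp add: power2_norm_add)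
    have "(norm (X y))\<^sup>2 = (norm (X u))\<^sup>2 + (norm (X v))\<^sup>2"
      unfolding y self_adjoint_add[OF X]
      by (rule orth) (simp_all add: uu uv self_adjoint_zero[OF X] flip: E_commute)
    moreover have "(norm y)\<^sup>2 = (norm u)\<^sup>2 + (norm v)\<^sup>2"
      unfolding y by (rule orth[OF uu uv])
    ultimately have "(e * norm y)\<^sup>2 \<le> (norm (X y))\<^sup>2"
      by (simp add: power_mult_distrib distrib_left)
    then show ?thesis by (rule power2_le_imp_le) simp
  qed
  show ?thesis
  proof (rule precompact_mono[where c=1])
    show "precompact (\<lambda>x. norm (E A (Q x)) + (1 / e) * norm (X (Q x)))"
      by (intro precompact_add preA precompact_mono[OF pre, where c="1 / e"]) (use e(1) in auto)
    fix x
    define y where "y = Q x - E A (Q x)"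
    have "E A y = 0" by (simp add: y_def saA oproj_idem[OF oA])
    then have "e * norm y \<le> norm (X y)" by (rule below)
    also have "X y = X (Q x) - E A (X (Q x))"
      by (simp add: y_def self_adjoint_diff[OF X] E_commute[OF A])
    also have "norm \<dots> \<le> norm (X (Q x))"
      by (rule oproj_compl_norm_le[OF oA])
    finally have "norm y \<le> (1 / e) * norm (X (Q x))"
      using e(1) by (simp add: field_simps)
    moreover have "norm (Q x) \<le> norm (E A (Q x)) + norm y"
      using norm_triangle_ineq[of "E A (Q x)" y] by (simp add: y_def)
    ultimately show "norm (Q x) \<le> 1 * (norm (E A (Q x)) + (1 / e) * norm (X (Q x)))"
      by simp
  qed simp
qed

end

theorem theorem5p1:
  fixes T S :: "'a::complex_hilbert_space \<Rightarrow> 'a"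
    and D :: "real \<Rightarrow> 'a \<Rightarrow> 'a"
  assumes "separable_space (euclidean :: 'a topology)"
    and "\<not> finite_dim (UNIV :: 'a set)"
    and "self_adjoint T"
    and "self_adjoint S" and "compact_op S"
    and "\<And>lam. D lam = (\<lambda>x. spectral_projection (\<lambda>y. T y + S y) {..<lam} x
                               - spectral_projection T {..<lam} x)"
  shows "(\<forall>lam::real. complex_of_real lam \<notin> ess_spectrum T \<longrightarrow>
            compact_op (D lam) \<and> 0 \<in> ess_spectrum (D lam)) \<and>
         countable {lam::real. complex_of_real lam \<in> ess_spectrum T \<and> 0 \<notin> ess_spectrum (D lam)}"
proof -
  note T = assms(3)
  define T' where "T' = (\<lambda>y. T y + S y)"
  have T': "self_adjoint T'"
    unfolding T'_def by (rule self_adjoint_plus[OF T assms(4)])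
  obtain E where E: "spectral_measure_of T E" by (rule spectral_measure_exists[OF T])
  obtain E' where E': "spectral_measure_of T' E'" by (rule spectral_measure_exists[OF T'])
  have D: "D lam = (\<lambda>x. E' {..<lam} x - E {..<lam} x)" for lam
    unfolding assms(6) T'_def[symmetric] spectral_projection_eq[OF T E] spectral_projection_eq[OF T' E'] ..
  note oE = E_oproj[OF T E] and oE' = E_oproj[OF T' E']
  have compl: "- {..<t} = {t..}" for t :: real by auto
  have E_ge: "E {t..} x = x - E {..<t} x" and E'_ge: "E' {t..} x = x - E' {..<t} x" for t x
    using E_compl[OF T E, of "{..<t}" x] E_compl[OF T' E', of "{..<t}" x] by (simp_all add: compl)
  have saD: "self_adjoint (D lam)" for lam
    unfolding D by (intro self_adjoint_minus oproj_self_adjoint oE oE') auto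
  have preS: "precompact (\<lambda>x. norm (T' x - T x))"
    using precompact_compact_op[OF assms(5)] by (simp add: T'_def)
  have lower: "precompact (\<lambda>x. norm (E' {lam..} (E {..<mu} x)))" if "mu < lam" for mu lam
    by (rule precompact_separated[OF T T' preS oE E_commute[OF T E] oE' E_commute[OF T' E']
          E_form_le[OF T E] E_form_ge[OF T' E'] that]) auto
  have upper: "precompact (\<lambda>x. norm (E' {..<lam} (E {mu..} x)))" if "lam < mu" for mu lam
  \<comment> \<open>Negating both operators reverses the order of the two half-lines.\<close>
  proof (rule precompact_separated[OF self_adjoint_uminus[OF T] self_adjoint_uminus[OF T'], where
        Q="E {mu..}" and R="E' {..<lam}" and a="- mu" and b="- lam"])
    show "precompact (\<lambda>x. norm (- T' x - - T x))"
      using preS by (simp add: norm_minus_commute)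
    show "orthogonal_projection (E {mu..})" "orthogonal_projection (E' {..<lam})"
      by (simp_all add: oE oE')
    show "- T (E {mu..} x) = E {mu..} (- T x)" for x
      using self_adjoint_scaleR[OF oproj_self_adjoint[OF oE[of "{mu..}"]], of "-1" "T x"]
      by (simp add: E_commute[OF T E])
    show "- T' (E' {..<lam} x) = E' {..<lam} (- T' x)" for x
      using self_adjoint_scaleR[OF oproj_self_adjoint[OF oE'[of "{..<lam}"]], of "-1" "T' x"]
      by (simp add: E_commute[OF T' E'])
    show "rinner (- T x) x \<le> - mu * (norm x)\<^sup>2" if "E {mu..} x = x" for x
      using E_form_ge[OF T E _ _ that, of mu] by (simp add: rinner.minus_left)
    show "- lam * (norm x)\<^sup>2 \<le> rinner (- T' x) x" if "E' {..<lam} x = x" for x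
      using E_form_le[OF T' E' _ _ that, of lam] by (simp add: rinner.minus_left subset_eq less_imp_le)
    show "- mu < - lam" using that by simp
  qed
  \<comment> \<open>Infinite dimension of the space enters here.\<close>
  have not_precompact_id: "\<not> precompact (\<lambda>x::'a. norm x)"
    using finite_dim_range_if_precompact[OF oproj_id] assms(2) by auto
  have zero: "precompact (\<lambda>x. norm (Q x))"
    if "0 \<notin> ess_spectrum (D lam)" "orthogonal_projection Q" "precompact (\<lambda>x. norm (D lam (Q x)))" for lam Q
  proof -
    obtain G where "spectral_measure_of (D lam) G" by (rule spectral_measure_exists[OF saD])
    with not_ess_spectrum_zero[OF saD] that show ?thesis by blast
  qed
  have "compact_op (D lam) \<and> 0 \<in> ess_spectrum (D lam)" if lam: "complex_of_real lam \<notin> ess_spectrum T" for lam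
  proof -
    obtain e where e: "e > 0" "precompact (\<lambda>x. norm (E {lam - e..<lam + e} x))"
      by (rule finite_rank_if_not_ess_spectrum[OF T E lam]) 
    let ?N = "{lam - e..<lam + e}"
    have small: "norm (E A x) \<le> norm (E ?N x)" if "A \<in> sets borel" "A \<subseteq> ?N" for A x
    proof -
      have "E A x = E A (E ?N x)"
        using that E_mult[OF T E, of A ?N x] by (simp add: Int_absorb2)
      then show ?thesis
        using oproj_norm_le[OF oE[OF that(1)], of "E ?N x"] by simp
    qed
    have "precompact (\<lambda>x. norm (D lam x))"
    proof (rule precompact_mono[where c=1])
      show "precompact (\<lambda>x. (norm (E' {lam..} (E {..<lam - e} x)) + norm (E' {..<lam} (E {lam + e..} x)))
          + (norm (E ?N x) + norm (E ?N x)))"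
        using e by (intro precompact_add lower upper) auto
      fix x
      note saE' = self_adjointD[OF oproj_self_adjoint[OF oE']]
      \<comment> \<open>Removing \<open>?B\<close> and \<open>?C\<close> leaves half-lines of
        \<open>E\<close> at distance \<open>e\<close> from \<open>lam\<close>, as
        \<open>lower\<close> and \<open>upper\<close> require. The removed pieces lie in
        \<open>?N\<close> and are dominated by its precompact projection.\<close>
      let ?B = "{lam - e..<lam}" and ?C = "{lam..<lam + e}"
      have B: "E {..<lam} x = E {..<lam - e} x + E ?B x"
        using E_Un[OF T E, of "{..<lam - e}" ?B x] e(1) by (simp add: ivl_disj_un ivl_disj_int)
      have C: "E {lam..} x = E ?C x + E {lam + e..} x"
        using E_Un[OF T E, of ?C "{lam + e..}" x] e(1) by (simp add: ivl_disj_un ivl_disj_int)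
      have "D lam x = E' {..<lam} (E {lam..} x) - E' {lam..} (E {..<lam} x)"
        by (simp add: D E_ge E'_ge saE')
      also have "\<dots> = (E' {..<lam} (E {lam + e..} x) - E' {lam..} (E {..<lam - e} x))
          + (E' {..<lam} (E ?C x) - E' {lam..} (E ?B x))"
        unfolding B C by (simp add: saE')
      also have "norm \<dots> \<le> (norm (E' {..<lam} (E {lam + e..} x)) + norm (E' {lam..} (E {..<lam - e} x)))
          + (norm (E' {..<lam} (E ?C x)) + norm (E' {lam..} (E ?B x)))"
        by (intro norm_triangle_le add_mono norm_triangle_ineq4)
      also have "norm (E' {..<lam} (E ?C x)) \<le> norm (E ?N x)"
        using e(1) by (intro order_trans[OF oproj_norm_le[OF oE'] small]) auto
      also have "norm (E' {lam..} (E ?B x)) \<le> norm (E ?N x)"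
        using e(1) by (intro order_trans[OF oproj_norm_le[OF oE'] small]) auto
      finally show "norm (D lam x) \<le> 1 * ((norm (E' {lam..} (E {..<lam - e} x)) + norm (E' {..<lam} (E {lam + e..} x)))
          + (norm (E ?N x) + norm (E ?N x)))" by simp
    qed simp
    \<comment> \<open>Taking the identity for \<open>Q\<close> in \<open>zero\<close> shows that 0
      cannot be missing from the essential spectrum.\<close>
    then show ?thesis
      using zero[of lam "\<lambda>x. x", OF _ oproj_id] not_precompact_id compact_op_if_precompact[OF saD, of lam]
      by metis
  qed
  moreover have "countable {lam. complex_of_real lam \<in> ess_spectrum T \<and> 0 \<notin> ess_spectrum (D lam)}" (is "countable ?L")
  proof -
    have less_False: False if "0 \<notin> ess_spectrum (D a)" "0 \<notin> ess_spectrum (D b)" "a < b" for a b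
    proof -
      \<comment> \<open>\<open>m\<close> leaves a gap to both points. Below \<open>m\<close>,
        \<open>E {..<b}\<close> acts as the identity and \<open>D b\<close> reduces to
        \<open>- E' {b..}\<close>; above \<open>m\<close>, \<open>E {..<a}\<close> vanishes and
        \<open>D a\<close> reduces to \<open>E' {..<a}\<close>. Each is a separated product.\<close>
      define m where "m = (a + b) / 2"
      have m: "a < m" "m < b" using \<open>a < b\<close> by (auto simp: m_def)
      have "D b (E {..<m} x) = - E' {b..} (E {..<m} x)" for x
      proof -
        have "{..<b} \<inter> {..<m} = {..<m}" using m by auto
        then show ?thesis by (simp add: D E'_ge E_mult[OF T E])
      qed
      with lower[OF m(2)] have 1: "precompact (\<lambda>x. norm (E {..<m} x))"
        using zero[OF that(2) oE, of "{..<m}"] by simp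
      have "D a (E {m..} x) = E' {..<a} (E {m..} x)" for x
      proof -
        have "{..<a} \<inter> {m..} = {}" using m by auto
        then show ?thesis
          by (simp add: D E_mult[OF T E] pvm_empty[OF spectral_measure_pvm[OF T E]])
      qed
      with upper[OF m(1)] have 2: "precompact (\<lambda>x. norm (E {m..} x))"
        using zero[OF that(1) oE, of "{m..}"] by simp
      have "precompact (\<lambda>x::'a. norm x)"
      proof (rule precompact_mono[OF precompact_add[OF 1 2], where c=1])
        show "norm x \<le> 1 * (norm (E {..<m} x) + norm (E {m..} x))" for x
          using norm_triangle_ineq[of "E {..<m} x" "E {m..} x"] by (simp add: E_ge)
      qed simp
      with not_precompact_id show False ..
    qed
    have "?L \<subseteq> {a}" if "a \<in> ?L" for a
    proof
      fix b assume "b \<in> ?L"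
      with that have "0 \<notin> ess_spectrum (D a)" "0 \<notin> ess_spectrum (D b)" by auto
      then have "\<not> a < b" "\<not> b < a" using less_False[of a b] less_False[of b a] by auto
      then show "b \<in> {a}" by simp
    qed
    then have "finite ?L"
      by (cases "?L = {}") (auto intro: finite_subset)
    then show ?thesis by (rule countable_finite)
  qed
  ultimately show ?thesis by blast
qed

end
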